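(* Let $F$ be a field of characteristic zero, let $\Gamma$ be a commutative semigroup, and let $A=\bigoplus_{g\in\Gamma}A_g$ be a finite dimensional $\Gamma$-graded $F$-algebra (not necessarily associative). If $A$ is graded simple, then the limit $$exp^{gr}(A)=\lim_{n\to\infty}\sqrt[n]{c_n^{gr}(A)}$$ exists.
   Context: Algebras are over $F$ and not necessarily associative. An algebra $A$ is $\Gamma$-graded if $A=\bigoplus_{g\in\Gamma}A_g$ as a vector space and $A_gA_h\subseteq A_{gh}$ for all $g,h\in\Gamma$. A subspace $V\subseteq A$ is homogeneous if $V=\bigoplus_{g\in\Gamma}(V\cap A_g)$. $A$ is graded simple if it has no homogeneous two-sided ideals other than $0$ and $A$. The support is $\mathrm{Supp}\,A=\{g\in\Gamma: A_g\ne 0\}=\{g_1,\ldots,g_k\}$ (distinct elements). Let $F\{X\}$ be the absolutely free (nonassociative) algebra on $X=\bigcup_{g\in\Gamma}X_g$ (disjoint union), each $X_g$ infinite, graded by giving each $x\in X_g$ degree $g$. A polynomial $f(x_1,\ldots,x_m)$ with $x_i\in X_{h_i}$ is a graded identity of $A$ if $f(a_1,\ldots,a_m)=0$ for all $a_i\in A_{h_i}$; $Id^{gr}(A)$ is the ideal of all graded identities of $A$. For integers $n_1,\ldots,n_k\ge 0$ with $n_1+\cdots+n_k=n\ge 1$, let $P_{n_1,\ldots,n_k}$ be the space of multilinear polynomials of total degree $n$ in variables $x^{(i)}_1,\ldots,x^{(i)}_{n_i}\in X_{g_i}$, $1\le i\le k$. The partial codimension is $c_{n_1,\ldots,n_k}(A)=\dim\left(P_{n_1,\ldots,n_k}/(P_{n_1,\ldots,n_k}\cap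 Id^{gr}(A))\right)$, and the graded codimension is $$c_n^{gr}(A)=\sum_{n_1+\cdots+n_k=n}\binom{n}{n_1,\ldots,n_k}c_{n_1,\ldots,n_k}(A),$$ the sum being over nonnegative integers. The limit $exp^{gr}(A)$, if it exists, is called the graded PI-exponent of $A$. *)

theory Defs
  imports Complex_Main "HOL-Library.Multiset" "HOL-Library.Poly_Mapping"
begin

section \<open>Direct sums and dimensions of quotient spaces\<close>

context vector_space
begin

definition direct_sum :: "'b set \<Rightarrow> ('i \<Rightarrow> 'b set) \<Rightarrow> bool" where
  "direct_sum V W \<longleftrightarrow>
     subspace V \<and> (\<forall>i. subspace (W i) \<and> W i \<subseteq> V) \<and>
     (\<forall>v\<in>V. \<exists>!c. (\<forall>i. c i \<in> W i) \<and> finite {i. c i \<noteq> 0} \<and> v = (\<Sum>i | c i \<noteq> 0. c i))"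

text \<open>
  A set \<open>B\<close> of representatives such that the cosets \<open>b + W\<close>, for \<open>b \<in> B\<close>, are pairwise distinct and
  form a basis of the quotient space \<open>V / W\<close>.  A linear combination of cosets is zero in
  \<open>V / W\<close> iff the corresponding combination of representatives lies in \<open>W\<close>.
\<close>
definition quotient_basis :: "'b set \<Rightarrow> 'b set \<Rightarrow> 'b set \<Rightarrow> bool" where
  "quotient_basis V W B \<longleftrightarrow>
     B \<subseteq> V \<and>
     (\<forall>S u. finite S \<and> S \<subseteq> B \<and> (\<Sum>b\<in>S. u b *s b) \<in> W \<longrightarrow> (\<forall>b\<in>S. u b = 0)) \<and>
     (\<forall>v\<in>V. \<exists>x\<in>span B. v - x \<in> W)"

text \<open>As with \<^const>\<open>dim\<close>, the value is \<open>0\<close> if the quotient is infinite dimensional.\<close>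
definition quotient_dim :: "'b set \<Rightarrow> 'b set \<Rightarrow> nat" where
  "quotient_dim V W = card (SOME B. local.quotient_basis V W B)"

lemma quotient_basis_exists:
  assumes V: "subspace V" and W: "subspace W" and WV: "W \<subseteq> V"
  shows "\<exists>B. local.quotient_basis V W B"
proof -
  obtain W0 where W0: "W0 \<subseteq> W" "independent W0" "W \<subseteq> span W0"
    using basis_exists[of W] by metis
  obtain C where C: "W0 \<subseteq> C" "C \<subseteq> V" "independent C" "V \<subseteq> span C"
    using maximal_independent_subset_extend[OF subset_trans[OF W0(1) WV] W0(2)] by blast
  have sW: "span W0 = W"
    using W0 W by (metis span_minimal subset_antisym)
  define B where "B = C - W0"
  have ind: "\<forall>b\<in>S. u b = 0" if S: "finite S" "S \<subseteq> B" "(\<Sum>b\<in>S. u b *s b) \<in> W" for S u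
  proof -
    have "(\<Sum>b\<in>S. u b *s b) \<in> span W0" using S sW by simp
    then obtain T r where T: "finite T" "T \<subseteq> W0" "(\<Sum>b\<in>S. u b *s b) = (\<Sum>a\<in>T. r a *s a)"
      unfolding span_explicit by blast
    have disj: "S \<inter> T = {}" using S T unfolding B_def by auto
    define q where "q b = (if b \<in> S then u b else - r b)" for b
    have "(\<Sum>b\<in>S \<union> T. q b *s b) = (\<Sum>b\<in>S. q b *s b) + (\<Sum>b\<in>T. q b *s b)"
      using S T disj by (intro sum.union_disjoint) auto
    also have "(\<Sum>b\<in>S. q b *s b) = (\<Sum>b\<in>S. u b *s b)"
      by (intro sum.cong) (auto simp: q_def)
    also have "(\<Sum>b\<in>T. q b *s b) = (\<Sum>b\<in>T. - (r b *s b))"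
      using disj by (intro sum.cong) (auto simp: q_def)
    finally have z: "(\<Sum>b\<in>S \<union> T. q b *s b) = 0" using T by (simp add: sum_negf)
    have "S \<union> T \<subseteq> C" using S T C unfolding B_def by auto
    then have "\<forall>b\<in>S \<union> T. q b = 0"
      using independentD[OF C(3) _ _ z] S(1) T(1) by blast
    moreover have "q b = u b" if "b \<in> S" for b using that by (simp add: q_def)
    ultimately show ?thesis by fastforce
  qed
  have "\<exists>x\<in>span B. v - x \<in> W" if "v \<in> V" for v
  proof -
    have "v \<in> span (B \<union> W0)"
      using that C unfolding B_def by (metis Diff_partition Un_commute subsetD)
    then obtain x y where "x \<in> span B" "y \<in> span W0" "v = x + y"
      unfolding span_Un by auto
    then show ?thesis using sW by (intro bexI[of _ x]) auto
  qed
  moreover have "B \<subseteq> V" using C by (auto simp: B_def)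
  ultimately have "local.quotient_basis V W B"
    unfolding local.quotient_basis_def using ind by blast
  then show ?thesis ..
qed

lemma card_quotient_basis:
  assumes V: "subspace V" and W: "subspace W" and WV: "W \<subseteq> V"
    and fin: "finite S" "V \<subseteq> span S" and B: "local.quotient_basis V W B"
  shows "finite B" "card B + dim W = dim V"
proof -
  obtain W0 where W0: "W0 \<subseteq> W" "independent W0" "W \<subseteq> span W0" "card W0 = dim W"
    using basis_exists[of W] by metis
  have BV: "B \<subseteq> V" and ind: "\<And>S u. finite S \<Longrightarrow> S \<subseteq> B \<Longrightarrow> (\<Sum>b\<in>S. u b *s b) \<in> W \<Longrightarrow> \<forall>b\<in>S. u b = 0"
    and spn: "\<And>v. v \<in> V \<Longrightarrow> \<exists>x\<in>span B. v - x \<in> W"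
    using B unfolding local.quotient_basis_def by blast+
  have disj: "B \<inter> W0 = {}"
  proof (rule ccontr)
    assume "B \<inter> W0 \<noteq> {}"
    then obtain b where b: "b \<in> B" "b \<in> W" using W0 by auto
    then show False using ind[of "{b}" "\<lambda>_. 1"] by auto
  qed
  have indep: "independent (B \<union> W0)"
    unfolding independent_explicit_module
  proof (intro allI impI)
    fix T u v
    assume T: "finite T" "T \<subseteq> B \<union> W0" "(\<Sum>v\<in>T. u v *s v) = 0" "v \<in> T"
    have eq: "(\<Sum>v\<in>T. u v *s v) = (\<Sum>v\<in>T \<inter> B. u v *s v) + (\<Sum>v\<in>T \<inter> W0. u v *s v)"
    proof -
      have "T = (T \<inter> B) \<union> (T \<inter> W0)" using T by auto
      then have "(\<Sum>v\<in>T. u v *s v) = (\<Sum>v\<in>(T \<inter> B) \<union> (T \<inter> W0). u v *s v)"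
        by (rule sum.cong[OF _ refl])
      also have "\<dots> = (\<Sum>v\<in>T \<inter> B. u v *s v) + (\<Sum>v\<in>T \<inter> W0. u v *s v)"
        using T disj by (intro sum.union_disjoint) auto
      finally show ?thesis .
    qed
    have w: "(\<Sum>v\<in>T \<inter> W0. u v *s v) \<in> W"
      using W W0 by (intro subspace_sum subspace_scale) auto
    have "(\<Sum>v\<in>T \<inter> B. u v *s v) = - (\<Sum>v\<in>T \<inter> W0. u v *s v)"
      using eq T(3) by (simp add: eq_neg_iff_add_eq_0)
    then have "(\<Sum>v\<in>T \<inter> B. u v *s v) \<in> W" using w W by (simp add: subspace_neg)
    then have z1: "\<forall>v\<in>T \<inter> B. u v = 0" using ind[of "T \<inter> B" u] T(1) by simp
    then have "(\<Sum>v\<in>T \<inter> B. u v *s v) = 0" by (intro sum.neutral) auto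
    then have z: "(\<Sum>v\<in>T \<inter> W0. u v *s v) = 0" using eq T(3) by simp
    have "\<forall>v\<in>T \<inter> W0. u v = 0"
      using independentD[OF W0(2) _ _ z] T(1) by blast
    then show "u v = 0" using z1 T by blast
  qed
  have sub: "B \<union> W0 \<subseteq> V" using BV W0 WV by auto
  have "finite (B \<union> W0)"
    using independent_span_bound[OF fin(1) indep] sub fin by blast
  then show fB: "finite B" by simp
  have "V \<subseteq> span (B \<union> W0)"
  proof
    fix v assume "v \<in> V"
    then obtain x where "x \<in> span B" "v - x \<in> W" using spn by blast
    then have "x \<in> span (B \<union> W0)" "v - x \<in> span (B \<union> W0)"
      using W0 span_mono[of B "B \<union> W0"] span_mono[of W0 "B \<union> W0"] by auto
    then show "v \<in> span (B \<union> W0)" using span_add by fastforce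
  qed
  then have "card (B \<union> W0) = dim V"
    using sub indep by (metis basis_card_eq_dim)
  then show "card B + dim W = dim V"
    using \<open>finite (B \<union> W0)\<close> disj W0(4) by (simp add: card_Un_disjoint)
qed

corollary quotient_dim_plus_dim:
  assumes "subspace V" "subspace W" "W \<subseteq> V" "finite S" "V \<subseteq> span S"
  shows "local.quotient_dim V W + dim W = dim V"
  unfolding local.quotient_dim_def
  using local.card_quotient_basis(2)[OF assms someI_ex[OF local.quotient_basis_exists[OF assms(1-3)]]] .

end


section \<open>Graded algebras\<close>

locale nonassoc_algebra = vector_space scale
  for scale :: "'f::field \<Rightarrow> 'a::ab_group_add \<Rightarrow> 'a" (infixr \<open>*s\<close> 75) +
  fixes mult :: "'a \<Rightarrow> 'a \<Rightarrow> 'a" (infixl \<open>\<bullet>\<close> 70)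
  assumes mult_add_left: "(x + y) \<bullet> z = x \<bullet> z + y \<bullet> z"
    and mult_add_right: "x \<bullet> (y + z) = x \<bullet> y + x \<bullet> z"
    and mult_scale_left: "(c *s x) \<bullet> y = c *s (x \<bullet> y)"
    and mult_scale_right: "x \<bullet> (c *s y) = c *s (x \<bullet> y)"
begin

lemma mult_zero_left: "0 \<bullet> x = 0"
  using mult_scale_left[of 0 0 x] by simp

lemma mult_zero_right: "x \<bullet> 0 = 0"
  using mult_scale_right[of x 0 0] by simp

definition two_sided_ideal :: "'a set \<Rightarrow> bool" where
  "two_sided_ideal I \<longleftrightarrow> subspace I \<and> (\<forall>x\<in>I. \<forall>a. a \<bullet> x \<in> I \<and> x \<bullet> a \<in> I)"

end

locale graded_algebra = nonassoc_algebra scale mult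
  for scale :: "'f::field \<Rightarrow> 'a::ab_group_add \<Rightarrow> 'a" (infixr \<open>*s\<close> 75)
    and mult :: "'a \<Rightarrow> 'a \<Rightarrow> 'a" (infixl \<open>\<bullet>\<close> 70) +
  fixes A :: "'g::semigroup_mult \<Rightarrow> 'a set"
  assumes grading: "local.direct_sum UNIV A"
    and graded_mult: "x \<in> A g \<Longrightarrow> y \<in> A h \<Longrightarrow> x \<bullet> y \<in> A (g * h)"
begin

definition homogeneous :: "'a set \<Rightarrow> bool" where
  "homogeneous V \<longleftrightarrow> local.direct_sum V (\<lambda>g. V \<inter> A g)"

definition graded_simple :: bool where
  "graded_simple \<longleftrightarrow> (\<forall>I. two_sided_ideal I \<and> homogeneous I \<longrightarrow> I = {0} \<or> I = UNIV)"

definition supp :: "'g set" where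
  "supp = {g. A g \<noteq> {0}}"

end


section \<open>The absolutely free algebra\<close>

text \<open>
  The nonassociative monomials are the binary trees with leaves labelled by variables. They
  form a basis of the free algebra, whose elements are thus the finitely supported functions from
  monomials to the field.
\<close>
datatype 'x monomial = Var 'x | Prod "'x monomial" "'x monomial"

type_synonym ('x, 'f) free_alg = "'x monomial \<Rightarrow>\<^sub>0 'f"

lift_definition free_scale :: "'f::field \<Rightarrow> ('x, 'f) free_alg \<Rightarrow> ('x, 'f) free_alg"
  is "\<lambda>c p m. c * p m"
  by (auto intro: finite_subset[rotated])

definition free_mult :: "('x, 'f::field) free_alg \<Rightarrow> ('x, 'f) free_alg \<Rightarrow> ('x, 'f) free_alg" where
  "free_mult p q =
     (\<Sum>s\<in>Poly_Mapping.keys p. \<Sum>t\<in>Poly_Mapping.keys q. Poly_Mapping.single (Prod s t) (Poly_Mapping.lookup p s * Poly_Mapping.lookup q t))"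

lemma lookup_free_mult:
  "Poly_Mapping.lookup (free_mult p q) m =
     (case m of Var x \<Rightarrow> 0 | Prod s t \<Rightarrow> Poly_Mapping.lookup p s * Poly_Mapping.lookup q t)"
proof (cases m)
  case (Var x)
  then show ?thesis by (simp add: free_mult_def lookup_sum lookup_single)
next
  case (Prod s t)
  have "Poly_Mapping.lookup (free_mult p q) m =
      (\<Sum>s'\<in>Poly_Mapping.keys p. \<Sum>t'\<in>Poly_Mapping.keys q. if s' = s \<and> t' = t then Poly_Mapping.lookup p s' * Poly_Mapping.lookup q t' else 0)"
    unfolding free_mult_def lookup_sum Prod lookup_single when_def
    by (intro sum.cong refl) auto
  also have "\<dots> = (\<Sum>s'\<in>Poly_Mapping.keys p. if s' = s then (\<Sum>t'\<in>Poly_Mapping.keys q. if t' = t then Poly_Mapping.lookup p s' * Poly_Mapping.lookup q t' else 0) else 0)"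
    by (intro sum.cong) auto
  also have "\<dots> = Poly_Mapping.lookup p s * Poly_Mapping.lookup q t"
    by (simp add: in_keys_iff)
  finally show ?thesis using Prod by simp
qed

interpretation free: nonassoc_algebra
  "free_scale :: 'f::field \<Rightarrow> ('x, 'f) free_alg \<Rightarrow> ('x, 'f) free_alg" free_mult
  by unfold_locales
    (auto intro!: poly_mapping_eqI
      simp: lookup_free_mult lookup_add free_scale.rep_eq algebra_simps split: monomial.splits)

fun var_mset :: "'x monomial \<Rightarrow> 'x multiset" where
  "var_mset (Var x) = {#x#}"
| "var_mset (Prod s t) = var_mset s + var_mset t"

text \<open>Polynomials in which every monomial contains each variable from the finite set \<open>Y\<close> exactly once
  and no others.\<close>
definition multilinear_polys :: "'x set \<Rightarrow> ('x, 'f::field) free_alg set" where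
  "multilinear_polys Y = {p. \<forall>m\<in>Poly_Mapping.keys p. var_mset m = mset_set Y}"


lemma subspace_multilinear_polys:
  "free.subspace (multilinear_polys Y :: ('x, 'f::field) free_alg set)"
proof (rule free.subspaceI)
  fix p q :: "('x, 'f) free_alg"
  assume "p \<in> multilinear_polys Y" "q \<in> multilinear_polys Y"
  then show "p + q \<in> multilinear_polys Y"
    using Poly_Mapping.keys_add[of p q] by (auto simp: multilinear_polys_def)
qed (auto simp: multilinear_polys_def in_keys_iff free_scale.rep_eq)


section \<open>Graded identities and graded codimensions\<close>

text \<open>
  The variables of degree \<open>g\<close> are the pairs \<open>(g, j)\<close>, so that \<open>X_g\<close> is countably infinite.
\<close>
type_synonym 'g gvar = "'g \<times> nat"

context nonassoc_algebra
begin

primrec eval_monomial :: "('x \<Rightarrow> 'a) \<Rightarrow> 'x monomial \<Rightarrow> 'a" where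
  "eval_monomial \<phi> (Var x) = \<phi> x"
| "eval_monomial \<phi> (Prod s t) = eval_monomial \<phi> s \<bullet> eval_monomial \<phi> t"

definition eval_poly :: "('x \<Rightarrow> 'a) \<Rightarrow> ('x, 'f) free_alg \<Rightarrow> 'a" where
  "eval_poly \<phi> p = (\<Sum>m\<in>Poly_Mapping.keys p. Poly_Mapping.lookup p m *s eval_monomial \<phi> m)"

lemma eval_poly_superset:
  assumes "finite M" "Poly_Mapping.keys p \<subseteq> M"
  shows "eval_poly \<phi> p = (\<Sum>m\<in>M. Poly_Mapping.lookup p m *s eval_monomial \<phi> m)"
  unfolding eval_poly_def using assms
  by (intro sum.mono_neutral_left) (auto simp: in_keys_iff)

lemma eval_poly_zero: "eval_poly \<phi> 0 = 0"
  by (simp add: eval_poly_def)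

lemma eval_poly_add: "eval_poly \<phi> (p + q) = eval_poly \<phi> p + eval_poly \<phi> q"
proof -
  let ?M = "Poly_Mapping.keys p \<union> Poly_Mapping.keys q"
  have "Poly_Mapping.keys (p + q) \<subseteq> ?M" by (rule Poly_Mapping.keys_add)
  then show ?thesis
    by (simp add: eval_poly_superset[of ?M] lookup_add scale_left_distrib sum.distrib)
qed

lemma eval_poly_scale: "eval_poly \<phi> (free_scale c p) = c *s eval_poly \<phi> p"
proof -
  have "Poly_Mapping.keys (free_scale c p) \<subseteq> Poly_Mapping.keys p"
    by (auto simp: in_keys_iff free_scale.rep_eq)
  then show ?thesis
    by (simp add: eval_poly_superset[of "Poly_Mapping.keys p"] free_scale.rep_eq scale_sum_right)
qed

lemma eval_poly_sum: "eval_poly \<phi> (\<Sum>i\<in>I. p i) = (\<Sum>i\<in>I. eval_poly \<phi> (p i))"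
  by (induction I rule: infinite_finite_induct) (auto simp: eval_poly_zero eval_poly_add)

lemma eval_poly_single: "eval_poly \<phi> (Poly_Mapping.single m c) = c *s eval_monomial \<phi> m"
  by (simp add: eval_poly_superset[of "{m}"])

lemma eval_poly_mult: "eval_poly \<phi> (free_mult p q) = eval_poly \<phi> p \<bullet> eval_poly \<phi> q"
proof -
  interpret l: additive "\<lambda>x. x \<bullet> y" for y
    by unfold_locales (rule mult_add_left)
  interpret r: additive "\<lambda>y. x \<bullet> y" for x
    by unfold_locales (rule mult_add_right)
  show ?thesis
    unfolding free_mult_def eval_poly_sum eval_poly_single
    unfolding eval_poly_def l.sum
    unfolding r.sum
    by (simp add: mult_scale_left mult_scale_right mult.commute[of "Poly_Mapping.lookup q _"])
qed

end

context graded_algebra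
begin

text \<open>
  Substitutions assign an element of the right degree to all variables at once; this is the same as
  substituting for the variables of a given polynomial only, as \<open>0\<close> lies in every component.
\<close>
definition graded_identities :: "('g gvar, 'f) free_alg set" where
  "graded_identities = {f. \<forall>\<phi>. (\<forall>g j. \<phi> (g, j) \<in> A g) \<longrightarrow> eval_poly \<phi> f = 0}"

lemma two_sided_ideal_graded_identities: "free.two_sided_ideal graded_identities"
  unfolding free.two_sided_ideal_def free.subspace_def graded_identities_def
  by (auto simp: eval_poly_zero eval_poly_add eval_poly_scale eval_poly_mult mult_zero_left mult_zero_right)

text \<open>
  A tuple \<open>(n_1, ..., n_k)\<close> is represented by the function \<open>\<nu>\<close> with \<open>\<nu> g_i = n_i\<close> that vanishes
  outside the support \<open>{g_1, ..., g_k}\<close>.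
\<close>
definition compositions :: "nat \<Rightarrow> ('g \<Rightarrow> nat) set" where
  "compositions n = {\<nu>. (\<forall>g. g \<notin> supp \<longrightarrow> \<nu> g = 0) \<and> (\<Sum>g\<in>supp. \<nu> g) = n}"

definition multilinear_space :: "('g \<Rightarrow> nat) \<Rightarrow> ('g gvar, 'f) free_alg set" where
  "multilinear_space \<nu> = multilinear_polys (SIGMA g:supp. {1..\<nu> g})"

definition partial_codim :: "('g \<Rightarrow> nat) \<Rightarrow> nat" where
  "partial_codim \<nu> =
     free.quotient_dim (multilinear_space \<nu>) (multilinear_space \<nu> \<inter> graded_identities)"

definition graded_codim :: "nat \<Rightarrow> nat" where
  "graded_codim n =
     (\<Sum>\<nu>\<in>compositions n. (fact n div (\<Prod>g\<in>supp. fact (\<nu> g))) * partial_codim \<nu>)"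

end

end

theory Submission
  imports Defs "HOL-Combinatorics.Multiset_Permutations"
begin

text \<open>
  The idea is to show that the graded codimensions \<open>c n\<close> are almost supermultiplicative,
  \<open>c m * c n \<le> K * c (m + n + d)\<close>, where \<open>d\<close> is the dimension of the algebra and \<open>K\<close> a constant. As \<open>c\<close> grows
  at most exponentially, a shift of the index and Fekete's lemma then give the limit
  (\<open>convergent_root_if_almost_supermultiplicative\<close>).

  To compare codimensions, independent multilinear polynomials modulo identities are
  replaced by staircases: lists of polynomials \<open>f i\<close> and graded substitutions \<open>\<phi> i\<close> such that \<open>f i\<close> does not
  vanish at \<open>\<phi> i\<close> but \<open>f j\<close> vanishes at \<open>\<phi> i\<close> for all \<open>j > i\<close>. The length of a staircase is at most the codimension
  (\<open>staircase_length_le\<close>), and some staircase attains it up to the factor \<open>d\<close>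
  (\<open>exists_long_staircase\<close>). If \<open>(f, \<phi>)\<close> and \<open>(g, \<psi>)\<close> are staircases in disjoint variables, then
  the products \<open>f i * g j\<close> form a triangular array as well, and those \<open>(i, j)\<close> with nonzero diagonal value
  form a staircase (\<open>staircase_product\<close>).

  Diagonal values \<open>a\<close> and \<open>b\<close> may have zero product. They are homogeneous, since over a commutative semigroup all
  monomials in the same variables have the same degree. Hence graded simplicity applies: multiplying \<open>a\<close> from either side
  by homogeneous basis elements, at most \<open>d\<close> times, yields elements that span the algebra, and
  one of them has a nonzero product with \<open>b\<close> (\<open>exists_nonzero_word_product\<close>), unless the multiplication is zero
  altogether. The finitely many multiplication words do not depend on \<open>a\<close> and \<open>b\<close>. Each word turns the pairs for which it
  works into a staircase, with new variables in place of the basis elements, and together the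
  words account for all pairs (\<open>codim_mult_le\<close>).

  The multinomial coefficients take care of themselves when the codimensions are summed over
  the lists of degrees of \<open>n\<close> variables instead of tuples \<open>\<nu>\<close> (\<open>graded_codim_eq\<close>).
\<close>

section \<open>Superadditive sequences\<close>

text \<open>
  Fekete's lemma, with superadditivity required beyond the threshold \<open>R\<close> only. The limit is the
  supremum of the quotients: for a fixed \<open>q\<close> whose quotient is nearly optimal, \<open>t = k * q + r\<close> with
  bounded \<open>r\<close> makes the quotient at \<open>t\<close> nearly as large.
\<close>
lemma superadditive_quotient_convergent:
  fixes B :: "nat \<Rightarrow> real"
  assumes sup: "\<And>s t. s > R \<Longrightarrow> t > R \<Longrightarrow> B s + B t \<le> B (s + t)"
    and bound: "\<And>t. t > R \<Longrightarrow> B t \<le> M * real t"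
  shows "convergent (\<lambda>t. B t / real t)"
proof -
  define S where "S = (\<lambda>t. B t / real t) ` {R<..}"
  have bdd: "bdd_above S"
  proof (rule bdd_aboveI[of _ M])
    fix x assume "x \<in> S"
    then obtain t where "t > R" "x = B t / real t" by (auto simp: S_def)
    then show "x \<le> M" using bound[of t] by (simp add: divide_le_eq)
  qed
  have ne: "S \<noteq> {}" unfolding S_def by auto
  define L where "L = Sup S"
  have upper: "B t / real t \<le> L" if "t > R" for t
    unfolding L_def using that by (intro cSup_upper bdd) (auto simp: S_def)
  have mult_le: "real k * B q + B r \<le> B (k * q + r)" if "q > R" "r > R" for k q r
  proof (induction k)
    case (Suc k)
    have "real (Suc k) * B q + B r \<le> B q + B (k * q + r)" using Suc by (simp add: algebra_simps)
    also have "\<dots> \<le> B (q + (k * q + r))" using that by (intro sup) auto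
    finally show ?case by (simp add: algebra_simps)
  qed simp
  have "(\<lambda>t. B t / real t) \<longlonglongrightarrow> L"
  proof (rule order_tendstoI)
    fix a assume "a < L"
    then obtain q where q: "q > R" "a < B q / real q"
      using less_cSup_iff[OF ne bdd] by (auto simp: S_def L_def)
    define C where "C = 2 * \<bar>B q\<bar> + (\<Sum>r\<in>{q..<2*q}. \<bar>B r\<bar>)"
    have lower: "B q / real q - C / real t \<le> B t / real t" if t: "t \<ge> 2 * q" for t
    proof -
      \<comment> \<open>The remainder is taken in \<open>{q..<2*q}\<close>, where superadditivity is available.\<close>
      define k where "k = t div q - 1"
      define r where "r = q + t mod q"
      have tq: "t div q \<ge> 2" using t q by (metis div_le_mono div_mult_self_is_m mult.commute gr_implies_not0 not_gr0)
      have "t = (t div q) * q + t mod q" by simp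
      also have "t div q = Suc k" using tq by (simp add: k_def)
      finally have tk: "t = k * q + r" by (simp add: r_def)
      have r: "r \<in> {q..<2*q}" using q by (auto simp: r_def)
      have Br: "\<bar>B r\<bar> \<le> (\<Sum>r\<in>{q..<2*q}. \<bar>B r\<bar>)" using r by (intro member_le_sum) auto
      have "real k = real t / real q - real r / real q" using tk q by (simp add: field_simps)
      then have "real k * B q = real t * (B q / real q) - (real r / real q) * B q"
        by (simp only: left_diff_distrib) simp
      moreover have "(real r / real q) * B q \<le> 2 * \<bar>B q\<bar>"
      proof -
        have "real r / real q \<le> 2" using r q by (simp add: divide_le_eq)
        then have "(real r / real q) * \<bar>B q\<bar> \<le> 2 * \<bar>B q\<bar>" by (intro mult_right_mono) auto
        moreover have "(real r / real q) * B q \<le> (real r / real q) * \<bar>B q\<bar>"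
          by (intro mult_left_mono) auto
        ultimately show ?thesis using order_trans by blast
      qed
      ultimately have "real t * (B q / real q) - C \<le> B t"
        using mult_le[of q r k] q r Br tk unfolding C_def by auto
      then have "(real t * (B q / real q) - C) / real t \<le> B t / real t"
        by (intro divide_right_mono) auto
      then show ?thesis using t q by (simp add: diff_divide_distrib)
    qed
    have "(\<lambda>t. B q / real q - C / real t) \<longlonglongrightarrow> B q / real q - 0"
      by (intro tendsto_diff tendsto_const lim_const_over_n)
    then have "\<forall>\<^sub>F t in sequentially. a < B q / real q - C / real t"
      using q by (intro order_tendstoD) auto
    then show "\<forall>\<^sub>F t in sequentially. a < B t / real t"
      using eventually_ge_at_top[of "2 * q"]
      by eventually_elim (use lower in fastforce)
  next
    fix a assume "L < a"
    show "\<forall>\<^sub>F t in sequentially. B t / real t < a"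
      using eventually_gt_at_top[of R]
      by eventually_elim (use upper \<open>L < a\<close> in fastforce)
  qed
  then show ?thesis by (rule convergentI)
qed

text \<open>
  The logarithms of the sequence are superadditive after a shift, and the exponential bound keeps their
  quotients bounded, so that the limit of the roots is finite.
\<close>
lemma convergent_root_if_almost_supermultiplicative:
  fixes c :: "nat \<Rightarrow> real"
  assumes pos: "\<And>n. n > 0 \<Longrightarrow> c n > 0"
    and sup: "\<And>m n. m > 0 \<Longrightarrow> n > 0 \<Longrightarrow> c m * c n \<le> K * c (m + n + R)"
    and bound: "\<And>n. c n \<le> D * M ^ n"
    and K: "K > 0" and D: "D > 0" and M: "M \<ge> 1"
  shows "convergent (\<lambda>n. root n (c n))"
proof -
  \<comment> \<open>Shifting the index by \<open>R\<close> and dividing by \<open>K\<close> makes the logarithm superadditive.\<close>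
  define B where "B t = ln (c (t - R)) - ln K" for t
  have "convergent (\<lambda>t. B t / real t)"
  proof (rule superadditive_quotient_convergent[where R=R and M="ln M + \<bar>ln D - ln K\<bar>"])
    fix s t assume st: "s > R" "t > R"
    have "c (s - R) * c (t - R) \<le> K * c (s - R + (t - R) + R)"
      using st by (intro sup) auto
    also have "s - R + (t - R) + R = s + t - R" using st by simp
    finally have "ln (c (s - R) * c (t - R)) \<le> ln (K * c (s + t - R))"
      using pos[of "s - R"] pos[of "t - R"] st by (intro ln_mono) auto
    then show "B s + B t \<le> B (s + t)"
      using pos[of "s - R"] pos[of "t - R"] pos[of "s + t - R"] st K
      by (simp add: B_def ln_mult)
  next
    fix t assume t: "t > R"
    have "ln (c (t - R)) \<le> ln (D * M ^ (t - R))"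
      using bound[of "t - R"] pos[of "t - R"] t by simp
    also have "\<dots> = ln D + real (t - R) * ln M" using D M by (simp add: ln_mult ln_realpow)
    also have "\<dots> \<le> ln D + real t * ln M" using M by (intro add_left_mono mult_right_mono) auto
    finally have "B t \<le> (ln D - ln K) + real t * ln M" by (simp add: B_def)
    also have "ln D - ln K \<le> \<bar>ln D - ln K\<bar> * real t"
      using t mult_left_mono[of 1 "real t" "\<bar>ln D - ln K\<bar>"] by simp
    finally show "B t \<le> (ln M + \<bar>ln D - ln K\<bar>) * real t" by (simp add: algebra_simps)
  qed
  then obtain l where "(\<lambda>t. B t / real t) \<longlonglongrightarrow> l" by (auto simp: convergent_def)
  then have "(\<lambda>n. B (n + R) / real (n + R)) \<longlonglongrightarrow> l" by (rule LIMSEQ_ignore_initial_segment)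
  moreover have "(\<lambda>n. 1 + real R / real n) \<longlonglongrightarrow> 1 + 0"
    by (intro tendsto_add tendsto_const lim_const_over_n)
  ultimately have "(\<lambda>n. B (n + R) / real (n + R) * (1 + real R / real n) + ln K / real n) \<longlonglongrightarrow> l * (1 + 0) + 0"
    by (intro tendsto_add[OF tendsto_mult lim_const_over_n])
  then have "(\<lambda>n. exp (B (n + R) / real (n + R) * (1 + real R / real n) + ln K / real n)) \<longlonglongrightarrow> exp (l * (1 + 0) + 0)"
    by (rule tendsto_exp)
  moreover have "\<forall>\<^sub>F n in sequentially.
      exp (B (n + R) / real (n + R) * (1 + real R / real n) + ln K / real n) = root n (c n)"
    using eventually_gt_at_top[of 0]
  proof eventually_elim
    case (elim n)
    have "B (n + R) / real (n + R) * (1 + real R / real n) = B (n + R) / real n"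
      using elim by (simp add: divide_simps)
    then have "B (n + R) / real (n + R) * (1 + real R / real n) + ln K / real n = ln (c n) / real n"
      by (simp add: B_def diff_divide_distrib)
    moreover have "root n (c n) = exp (ln (c n) / real n)"
      using elim pos[of n] by (simp add: root_powr_inverse powr_def)
    ultimately show ?case by simp
  qed
  ultimately show ?thesis
    by (intro convergentI[where L="exp (l * (1 + 0) + 0)"]) (rule Lim_transform_eventually)
qed

section \<open>Homogeneous subspaces and graded simplicity\<close>

context graded_algebra
begin

lemma component_subspace: "subspace (A g)"
  using grading by (simp add: direct_sum_def)

lemma component_zero: "0 \<in> A g"
  using component_subspace by (rule subspace_0)

text \<open>
  Uniqueness of the homogeneous components is inherited from the whole algebra; what needs an
  argument is that the components of an element of the span lie in the span again, which is clear
  for a generator and preserved by linear combinations.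
\<close>
lemma homogeneous_span:
  assumes T: "T \<subseteq> (\<Union>g. A g)"
  shows "homogeneous (span T)"
  unfolding homogeneous_def direct_sum_def
proof (intro conjI allI ballI)
  fix v assume v: "v \<in> span T"
  have ex: "\<exists>c. (\<forall>g. c g \<in> span T \<inter> A g) \<and> finite {g. c g \<noteq> 0} \<and> v = (\<Sum>g | c g \<noteq> 0. c g)"
    using v
  proof (induction rule: span_induct_alt)
    case base
    then show ?case by (intro exI[of _ "\<lambda>_. 0"]) (auto simp: span_zero component_zero)
  next
    case (step k x y)
    then obtain c where c: "\<forall>g. c g \<in> span T \<inter> A g" "finite {g. c g \<noteq> 0}" "y = (\<Sum>g | c g \<noteq> 0. c g)"
      by blast
    obtain h where h: "x \<in> A h" using step T by auto
    define c' where "c' = c(h := c h + k *s x)"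
    let ?S = "insert h {g. c g \<noteq> 0}"
    have sub: "{g. c' g \<noteq> 0} \<subseteq> ?S" by (auto simp: c'_def)
    have "(\<Sum>g | c' g \<noteq> 0. c' g) = (\<Sum>g\<in>?S. c' g)"
      using c(2) sub by (intro sum.mono_neutral_left) auto
    also have "\<dots> = (c h + k *s x) + (\<Sum>g\<in>?S - {h}. c' g)"
      using c(2) by (subst sum.remove[of _ h]) (auto simp: c'_def)
    also have "(\<Sum>g\<in>?S - {h}. c' g) = (\<Sum>g\<in>?S - {h}. c g)"
      by (intro sum.cong) (auto simp: c'_def)
    also have "(c h + k *s x) + (\<Sum>g\<in>?S - {h}. c g) = k *s x + (c h + (\<Sum>g\<in>?S - {h}. c g))"
      by simp
    also have "c h + (\<Sum>g\<in>?S - {h}. c g) = (\<Sum>g\<in>?S. c g)"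
      using c(2) by (subst (2) sum.remove[of _ h]) auto
    also have "\<dots> = y" unfolding c(3) using c(2) by (intro sum.mono_neutral_right) auto
    finally have "k *s x + y = (\<Sum>g | c' g \<noteq> 0. c' g)" by simp
    moreover have "\<forall>g. c' g \<in> span T \<inter> A g"
      using c(1) h step component_subspace
      by (auto simp: c'_def span_add span_scale span_base subspace_add subspace_scale)
    moreover have "finite {g. c' g \<noteq> 0}" using sub c(2) by (auto intro: finite_subset)
    ultimately show ?case by blast
  qed
  have "\<exists>!c. (\<forall>g. c g \<in> A g) \<and> finite {g. c g \<noteq> 0} \<and> v = (\<Sum>g | c g \<noteq> 0. c g)"
    using grading by (simp add: direct_sum_def)
  then show "\<exists>!c. (\<forall>g. c g \<in> span T \<inter> A g) \<and> finite {g. c g \<noteq> 0} \<and> v = (\<Sum>g | c g \<noteq> 0. c g)"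
    using ex by (blast intro!: ex_ex1I)
qed (auto intro: subspace_inter component_subspace)

lemma graded_simple_span_eq_UNIV:
  assumes simple: graded_simple and T: "T \<subseteq> (\<Union>g. A g)"
    and ideal: "two_sided_ideal (span T)" and a: "a \<in> T" "a \<noteq> 0"
  shows "span T = UNIV"
  using simple ideal homogeneous_span[OF T] span_base[OF a(1)] a(2)
  unfolding graded_simple_def by blast

end

section \<open>Multilinear polynomials in the free algebra\<close>

lemma size_var_mset_pos: "size (var_mset m) > 0"
  by (induction m) auto

text \<open>
  Spaces of multilinear polynomials are finite dimensional because only finitely many binary trees
  have a given finite set of labels and a bounded number of leaves.
\<close>
lemma finite_monomials:
  assumes "finite Y"
  shows "finite {m. set_mset (var_mset m) \<subseteq> Y \<and> size (var_mset m) \<le> n}"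
proof (induction n)
  case 0
  have "{m. set_mset (var_mset m) \<subseteq> Y \<and> size (var_mset m) \<le> 0} = {}"
    using size_var_mset_pos by (metis (mono_tags, lifting) Collect_empty_eq not_le)
  then show ?case by (metis finite.emptyI)
next
  case (Suc n)
  let ?S = "{m. set_mset (var_mset m) \<subseteq> Y \<and> size (var_mset m) \<le> n}"
  have "m \<in> Var ` Y \<union> (\<lambda>(s, t). Prod s t) ` (?S \<times> ?S)"
    if "set_mset (var_mset m) \<subseteq> Y" "size (var_mset m) \<le> Suc n" for m
  proof (cases m)
    case (Prod s t)
    have "(s, t) \<in> ?S \<times> ?S"
      using that Prod size_var_mset_pos[of s] size_var_mset_pos[of t] by auto
    then show ?thesis using Prod by (intro UnI2 image_eqI[of _ _ "(s, t)"]) auto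
  qed (use that in auto)
  then have "{m. set_mset (var_mset m) \<subseteq> Y \<and> size (var_mset m) \<le> Suc n} \<subseteq>
      Var ` Y \<union> (\<lambda>(s, t). Prod s t) ` (?S \<times> ?S)" by blast
  then show ?case by (rule finite_subset) (use Suc assms in auto)
qed

lemma multilinear_polys_finite_span:
  assumes "finite Y"
  shows "\<exists>S. finite S \<and> multilinear_polys Y \<subseteq> free.span (S :: ('x, 'f::field) free_alg set)"
proof -
  let ?M = "{m. var_mset m = mset_set Y}"
  let ?S = "(\<lambda>m. Poly_Mapping.single m (1::'f)) ` ?M"
  have "?M \<subseteq> {m. set_mset (var_mset m) \<subseteq> Y \<and> size (var_mset m) \<le> card Y}"
    using assms by auto
  then have "finite ?M" using finite_monomials[OF assms] by (rule finite_subset)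
  then have fin: "finite ?S" by (rule finite_imageI)
  have "p \<in> free.span ?S" if "p \<in> multilinear_polys Y" for p
  proof -
    have "p = (\<Sum>m\<in>Poly_Mapping.keys p. Poly_Mapping.single m (Poly_Mapping.lookup p m))"
      by (intro poly_mapping_eqI) (auto simp: lookup_sum lookup_single when_def in_keys_iff)
    also have "\<dots> = (\<Sum>m\<in>Poly_Mapping.keys p.
        free_scale (Poly_Mapping.lookup p m) (Poly_Mapping.single m 1))"
      by (intro sum.cong refl poly_mapping_eqI)
         (auto simp: free_scale.rep_eq lookup_single when_def)
    also have "\<dots> \<in> free.span ?S"
      using that by (intro free.span_sum free.span_scale free.span_base) (auto simp: multilinear_polys_def)
    finally show ?thesis .
  qed
  then show ?thesis using fin by blast
qed

lemma free_mult_multilinear: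
  assumes "p \<in> multilinear_polys Y" "q \<in> multilinear_polys Z" "finite Y" "finite Z" "Y \<inter> Z = {}"
  shows "free_mult p q \<in> multilinear_polys (Y \<union> Z)"
proof -
  have "var_mset m = mset_set (Y \<union> Z)" if "m \<in> Poly_Mapping.keys (free_mult p q)" for m
    using that assms mset_set_Union[OF assms(3-5)]
    by (cases m) (auto simp: in_keys_iff lookup_free_mult multilinear_polys_def)
  then show ?thesis by (simp add: multilinear_polys_def)
qed

text \<open>
  The homomorphism of free algebras induced by a map of variables. It serves to make the variables
  of two polynomials disjoint before they are multiplied.
\<close>
definition rename_vars :: "('x \<Rightarrow> 'y) \<Rightarrow> ('x, 'f::field) free_alg \<Rightarrow> ('y, 'f) free_alg" where
  "rename_vars r p =
     (\<Sum>m\<in>Poly_Mapping.keys p. Poly_Mapping.single (map_monomial r m) (Poly_Mapping.lookup p m))"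

lemma var_mset_map_monomial: "var_mset (map_monomial r m) = image_mset r (var_mset m)"
  by (induction m) auto

lemma rename_vars_multilinear:
  assumes "p \<in> multilinear_polys Y" "inj_on r Y"
  shows "rename_vars r p \<in> multilinear_polys (r ` Y)"
proof -
  have "Poly_Mapping.keys (rename_vars r p) \<subseteq> map_monomial r ` Poly_Mapping.keys p"
    unfolding rename_vars_def by (rule order.trans[OF keys_sum]) auto
  then show ?thesis
    using assms by (auto simp: multilinear_polys_def var_mset_map_monomial image_mset_mset_set)
qed

context nonassoc_algebra
begin

lemma eval_poly_rename_vars: "eval_poly \<phi> (rename_vars r p) = eval_poly (\<phi> \<circ> r) p"
proof -
  have "eval_monomial \<phi> (map_monomial r m) = eval_monomial (\<phi> \<circ> r) m" for m
    by (induction m) auto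
  then show ?thesis unfolding rename_vars_def eval_poly_sum eval_poly_single
    by (simp add: eval_poly_def)
qed

lemma eval_monomial_cong:
  "(\<And>x. x \<in># var_mset m \<Longrightarrow> \<phi> x = \<psi> x) \<Longrightarrow> eval_monomial \<phi> m = eval_monomial \<psi> m"
  by (induction m) auto

lemma eval_poly_cong:
  assumes "p \<in> multilinear_polys Y" "finite Y" "\<And>y. y \<in> Y \<Longrightarrow> \<phi> y = \<psi> y"
  shows "eval_poly \<phi> p = eval_poly \<psi> p"
  unfolding eval_poly_def
  by (intro sum.cong arg_cong2[where f=scale] refl eval_monomial_cong)
     (use assms in \<open>auto simp: multilinear_polys_def\<close>)

lemma eval_monomial_linear:
  assumes "count (var_mset m) y = 1" "finite I"
  shows "eval_monomial (\<phi>(y := \<Sum>i\<in>I. c i *s x i)) m = (\<Sum>i\<in>I. c i *s eval_monomial (\<phi>(y := x i)) m)"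
  using assms(1)
proof (induction m)
  case (Prod s t)
  interpret l: additive "\<lambda>x. x \<bullet> z" for z
    by unfold_locales (rule mult_add_left)
  interpret r: additive "\<lambda>z. x \<bullet> z" for x
    by unfold_locales (rule mult_add_right)
  have const: "eval_monomial (\<phi>(y := a)) u = eval_monomial \<phi> u"
    if "count (var_mset u) y = 0" for u a
    using that by (intro eval_monomial_cong) (auto simp flip: not_in_iff)
  consider "count (var_mset s) y = 1" "count (var_mset t) y = 0"
    | "count (var_mset t) y = 1" "count (var_mset s) y = 0"
    using Prod.prems by fastforce
  then show ?case
  proof cases
    case 1
    then show ?thesis
      by (simp only: eval_monomial.simps const Prod.IH l.sum mult_scale_left)
  next
    case 2
    then show ?thesis
      by (simp only: eval_monomial.simps const Prod.IH r.sum mult_scale_right)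
  qed
qed auto

lemma eval_poly_linear:
  assumes "p \<in> multilinear_polys Y" "y \<in> Y" "finite Y" "finite I"
  shows "eval_poly (\<phi>(y := \<Sum>i\<in>I. c i *s x i)) p = (\<Sum>i\<in>I. c i *s eval_poly (\<phi>(y := x i)) p)"
proof -
  have "eval_poly (\<phi>(y := \<Sum>i\<in>I. c i *s x i)) p =
      (\<Sum>m\<in>Poly_Mapping.keys p. \<Sum>i\<in>I. c i *s Poly_Mapping.lookup p m *s eval_monomial (\<phi>(y := x i)) m)"
    unfolding eval_poly_def
  proof (intro sum.cong refl)
    fix m assume "m \<in> Poly_Mapping.keys p"
    then have "count (var_mset m) y = 1" using assms by (simp add: multilinear_polys_def)
    then show "Poly_Mapping.lookup p m *s eval_monomial (\<phi>(y := \<Sum>i\<in>I. c i *s x i)) m =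
        (\<Sum>i\<in>I. c i *s Poly_Mapping.lookup p m *s eval_monomial (\<phi>(y := x i)) m)"
      using assms(4) by (subst eval_monomial_linear) (simp_all add: scale_sum_right mult.commute)
  qed
  also have "\<dots> = (\<Sum>i\<in>I. c i *s eval_poly (\<phi>(y := x i)) p)"
    unfolding eval_poly_def scale_sum_right by (rule sum.swap)
  finally show ?thesis .
qed

end

primrec monomial_degree :: "'g::semigroup_mult gvar monomial \<Rightarrow> 'g" where
  "monomial_degree (Var x) = fst x"
| "monomial_degree (Prod s t) = monomial_degree s * monomial_degree t"

text \<open>
  Commutativity of the semigroup enters here, and through this lemma the values of a multilinear
  polynomial at graded substitutions are homogeneous. The semigroup may lack a unit, so the product of the degrees
  is a fold over an option type, with \<^const>\<open>None\<close> as the adjoined unit.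
\<close>
lemma monomial_degree_cong:
  fixes m m' :: "'g::ab_semigroup_mult gvar monomial"
  assumes "var_mset m = var_mset m'"
  shows "monomial_degree m = monomial_degree m'"
proof -
  define F :: "'g gvar \<Rightarrow> 'g option \<Rightarrow> 'g option"
    where "F x acc = Some (case acc of None \<Rightarrow> fst x | Some h \<Rightarrow> fst x * h)" for x acc
  interpret comp_fun_commute F
    by unfold_locales (auto simp: F_def fun_eq_iff ac_simps split: option.splits)
  have "fold_mset F acc (var_mset m) =
      Some (case acc of None \<Rightarrow> monomial_degree m | Some h \<Rightarrow> monomial_degree m * h)"
    for acc and m :: "'g gvar monomial"
    by (induction m arbitrary: acc) (auto simp: F_def ac_simps split: option.splits)
  from this[of None m] this[of None m'] assms show ?thesis by simp
qed

lemma (in graded_algebra) eval_monomial_in_component: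
  assumes "\<And>g j. \<phi> (g, j) \<in> A g"
  shows "eval_monomial \<phi> m \<in> A (monomial_degree m)"
  by (induction m) (use assms graded_mult in auto)

section \<open>Dimensions inside the free algebra\<close>

context vector_space
begin

lemma dim_less_of_psubset:
  assumes "subspace V" "subspace W" "W \<subset> V" "finite S" "V \<subseteq> span S"
  shows "dim W < dim V"
proof -
  obtain B where B: "local.quotient_basis V W B"
    using quotient_basis_exists[of V W] assms by blast
  have fin: "finite B" "card B + dim W = dim V"
    using card_quotient_basis[OF assms(1,2) _ assms(4,5) B] assms(3) by auto
  have "B \<noteq> {}"
  proof
    assume "B = {}"
    then have "V \<subseteq> W" using B by (auto simp: local.quotient_basis_def)
    then show False using assms by blast
  qed
  then show ?thesis using fin by (metis card_gt_0_iff less_add_same_cancel2)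
qed

end

text \<open>
  Finite dimensionality is given by an arbitrary basis, which is unrelated to the grading.
\<close>
locale finite_dim_graded_algebra =
  graded_algebra scale mult A + finite_dimensional_vector_space scale Basis
  for scale :: "'f::field \<Rightarrow> 'a::ab_group_add \<Rightarrow> 'a" (infixr \<open>*s\<close> 75)
    and mult :: "'a \<Rightarrow> 'a \<Rightarrow> 'a" (infixl \<open>\<bullet>\<close> 70)
    and A :: "'g::ab_semigroup_mult \<Rightarrow> 'a set"
    and Basis :: "'a set"
begin

text \<open>
  Evaluation at \<open>\<phi>\<close> is a linear map into the algebra, so its kernel loses at most the dimension of
  the algebra. The free algebra is infinite dimensional, hence the count goes through
  representatives of a basis of the quotient by the kernel, whose values are independent.
\<close>
lemma dim_vanishing_at_one:
  assumes U: "free.subspace U" and S: "finite S" "U \<subseteq> free.span S"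
  shows "free.dim U \<le> free.dim {u \<in> U. eval_poly \<phi> u = 0} + dimension"
proof -
  let ?W = "{u \<in> U. eval_poly \<phi> u = 0}"
  have W: "free.subspace ?W"
    using U by (auto simp: free.subspace_def eval_poly_zero eval_poly_add eval_poly_scale)
  obtain B where B: "free.quotient_basis U ?W B"
    using free.quotient_basis_exists[OF U W] by auto
  have fin: "finite B" "card B + free.dim ?W = free.dim U"
    using free.card_quotient_basis[OF U W _ S B] by auto
  have BU: "B \<subseteq> U" and ind: "\<And>T u. finite T \<Longrightarrow> T \<subseteq> B \<Longrightarrow>
      (\<Sum>b\<in>T. free_scale (u b) b) \<in> ?W \<Longrightarrow> \<forall>b\<in>T. u b = 0"
    using B unfolding free.quotient_basis_def by blast+
  have ker: "\<forall>b\<in>T. u b = 0"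
    if "T \<subseteq> B" "(\<Sum>b\<in>T. u b *s eval_poly \<phi> b) = 0" for T u
  proof (rule ind)
    show "finite T" using that fin by (auto intro: finite_subset)
    have "(\<Sum>b\<in>T. free_scale (u b) b) \<in> U"
      using that BU U by (intro free.subspace_sum free.subspace_scale) auto
    then show "(\<Sum>b\<in>T. free_scale (u b) b) \<in> ?W"
      using that by (simp add: eval_poly_sum eval_poly_scale)
  qed (use that in auto)
  have inj: "inj_on (eval_poly \<phi>) B"
  proof (rule inj_onI, rule ccontr)
    fix b c assume bc: "b \<in> B" "c \<in> B" "eval_poly \<phi> b = eval_poly \<phi> c" "b \<noteq> c"
    \<comment> \<open>\<open>b - c\<close> lies in the kernel, although its coefficients are not zero.\<close>
    have "\<forall>x\<in>{b, c}. (if x = b then 1 else - 1 :: 'f) = 0"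
      by (rule ker) (use bc in auto)
    then show False by auto
  qed
  have "independent (eval_poly \<phi> ` B)"
    unfolding independent_explicit_module
  proof (intro allI impI)
    fix T u v assume T: "finite T" "T \<subseteq> eval_poly \<phi> ` B" "(\<Sum>v\<in>T. u v *s v) = 0" "v \<in> T"
    define C where "C = {b \<in> B. eval_poly \<phi> b \<in> T}"
    have TC: "T = eval_poly \<phi> ` C" using T by (auto simp: C_def)
    have "(\<Sum>v\<in>T. u v *s v) = (\<Sum>b\<in>C. u (eval_poly \<phi> b) *s eval_poly \<phi> b)"
      unfolding TC using inj by (subst sum.reindex) (auto simp: C_def intro: inj_on_subset)
    then have "\<forall>b\<in>C. u (eval_poly \<phi> b) = 0"
      using T by (intro ker) (auto simp: C_def)
    then show "u v = 0" using T TC by auto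
  qed
  then have "card (eval_poly \<phi> ` B) \<le> dim UNIV" by (intro independent_card_le_dim) auto
  then have "card B \<le> dimension"
    using inj dim_subset_UNIV[of UNIV] by (simp add: card_image)
  then show ?thesis using fin by linarith
qed

lemma dim_vanishing_on:
  assumes U: "free.subspace U" and S: "finite S" "U \<subseteq> free.span S" and "finite \<Phi>"
  shows "free.dim U \<le> free.dim {u \<in> U. \<forall>\<phi>\<in>\<Phi>. eval_poly \<phi> u = 0} + dimension * card \<Phi>"
  using \<open>finite \<Phi>\<close>
proof induction
  case (insert \<phi> \<Phi>)
  let ?W = "{u \<in> U. \<forall>\<phi>\<in>\<Phi>. eval_poly \<phi> u = 0}"
  have "free.subspace ?W"
    using U by (auto simp: free.subspace_def eval_poly_zero eval_poly_add eval_poly_scale)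
  then have "free.dim ?W \<le> free.dim {u \<in> ?W. eval_poly \<phi> u = 0} + dimension"
    using S by (intro dim_vanishing_at_one[of _ S]) auto
  moreover have "{u \<in> ?W. eval_poly \<phi> u = 0} = {u \<in> U. \<forall>\<phi>\<in>insert \<phi> \<Phi>. eval_poly \<phi> u = 0}" by auto
  ultimately show ?case using insert by simp
qed simp

section \<open>Words in homogeneous basis elements\<close>

lemma sum_of_components_zero:
  assumes "finite G" "\<And>g. g \<in> G \<Longrightarrow> x g \<in> A g" "(\<Sum>g\<in>G. x g) = 0" "g \<in> G"
  shows "x g = 0"
proof -
  define c where "c g = (if g \<in> G then x g else 0)" for g
  have "{g. c g \<noteq> 0} \<subseteq> G" by (auto simp: c_def)
  then have fin: "finite {g. c g \<noteq> 0}" and "(\<Sum>g | c g \<noteq> 0. c g) = (\<Sum>g\<in>G. c g)"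
    using assms(1) by (auto intro: finite_subset sum.mono_neutral_left)
  moreover have "(\<Sum>g\<in>G. c g) = (\<Sum>g\<in>G. x g)" by (intro sum.cong) (auto simp: c_def)
  moreover define P where
    "P c \<longleftrightarrow> (\<forall>g. c g \<in> A g) \<and> finite {g. c g \<noteq> 0} \<and> 0 = (\<Sum>g | c g \<noteq> 0. c g)" for c
  ultimately have "P c" using assms component_zero by (auto simp: c_def)
  moreover have "P (\<lambda>_. 0)" using component_zero by (auto simp: P_def)
  moreover have "\<exists>!c. P c" using grading unfolding direct_sum_def P_def by blast
  ultimately have "c = (\<lambda>_. 0)" by blast
  then have "c g = 0" by simp
  then show ?thesis using assms(4) by (simp add: c_def)
qed

text \<open>
  Nonzero elements of different degrees are independent.
\<close>
lemma finite_supp: "finite supp"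
proof -
  have "\<exists>v. v \<in> A g \<and> v \<noteq> 0" if "g \<in> supp" for g
    using that component_zero[of g] by (auto simp: supp_def)
  then obtain a where a: "\<And>g. g \<in> supp \<Longrightarrow> a g \<in> A g" "\<And>g. g \<in> supp \<Longrightarrow> a g \<noteq> 0"
    by metis
  have inj: "inj_on a supp"
  proof (rule inj_onI, rule ccontr)
    fix g h assume gh: "g \<in> supp" "h \<in> supp" "a g = a h" "g \<noteq> h"
    have "(if g = g then a g else - a h) = 0"
    proof (rule sum_of_components_zero[of "{g, h}" "\<lambda>k. if k = g then a g else - a h"])
      show "(if k = g then a g else - a h) \<in> A k" if "k \<in> {g, h}" for k
        using that gh(4) a(1)[OF gh(1)] a(1)[OF gh(2)]
        by (auto intro: subspace_neg component_subspace)
    qed (use gh in auto)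
    then show False using a gh by auto
  qed
  have "independent (a ` supp)"
    unfolding independent_explicit_module
  proof (intro allI impI)
    fix T u v assume T: "finite T" "T \<subseteq> a ` supp" "(\<Sum>v\<in>T. u v *s v) = 0" "v \<in> T"
    define G where "G = {g \<in> supp. a g \<in> T}"
    have TG: "T = a ` G" using T by (auto simp: G_def)
    have injG: "inj_on a G" using inj by (auto simp: G_def intro: inj_on_subset)
    have finG: "finite G" using T(1) TG injG by (simp add: finite_image_iff)
    have "(\<Sum>g\<in>G. u (a g) *s a g) = 0"
      using T(3) unfolding TG by (simp add: sum.reindex[OF injG])
    then have "u (a g) *s a g = 0" if "g \<in> G" for g
      using finG that a component_subspace
      by (intro sum_of_components_zero[of G "\<lambda>g. u (a g) *s a g"]) (auto simp: G_def intro: subspace_scale)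
    moreover obtain g where "g \<in> G" "v = a g" using T(4) TG by blast
    ultimately show "u v = 0" using a by (auto simp: G_def)
  qed
  then have "finite (a ` supp)" by (rule finiteI_independent)
  then show ?thesis using inj by (simp add: finite_image_iff)
qed

definition component_basis :: "'g \<Rightarrow> 'a set" where
  "component_basis g = (SOME B. B \<subseteq> A g \<and> independent B \<and> A g \<subseteq> span B)"

lemma component_basis:
  "component_basis g \<subseteq> A g" "independent (component_basis g)" "A g \<subseteq> span (component_basis g)"
proof -
  have "\<exists>B. B \<subseteq> A g \<and> independent B \<and> A g \<subseteq> span B"
    using basis_exists[of "A g"] by metis
  from someI_ex[OF this] show "component_basis g \<subseteq> A g" "independent (component_basis g)"
    "A g \<subseteq> span (component_basis g)" by (auto simp: component_basis_def)
qed

lemma finite_component_basis: "finite (component_basis g)"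
  using component_basis(2) by (rule finiteI_independent)

lemma component_basis_nonzero: "0 \<notin> component_basis g"
  using component_basis(2) dependent_zero by blast

lemma card_component_basis: "card (component_basis g) \<le> dimension"
  using independent_card_le_dim[OF component_basis(1,2)[of g]] dim_subset_UNIV[of "A g"] by simp

text \<open>
  A letter \<open>(s, g, e)\<close> stands for multiplication by the basis element \<open>e\<close> of degree \<open>g\<close>, on the side
  chosen by \<open>s\<close>. The degree is recorded because it determines the multilinear space in which a product
  with \<open>e\<close> ends up.
\<close>
definition letters :: "(bool \<times> 'g \<times> 'a) set" where
  "letters = UNIV \<times> (SIGMA g:supp. component_basis g)"

lemma finite_letters: "finite letters"
  unfolding letters_def using finite_supp finite_component_basis by auto

lemma span_letters: "span (\<Union>g\<in>supp. component_basis g) = UNIV"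
proof -
  have A: "A g \<subseteq> span (\<Union>g\<in>supp. component_basis g)" for g
  proof (cases "g \<in> supp")
    case True
    then have "span (component_basis g) \<subseteq> span (\<Union>g\<in>supp. component_basis g)"
      by (intro span_mono) auto
    then show ?thesis using component_basis(3) by blast
  qed (auto simp: supp_def span_zero)
  have "v \<in> span (\<Union>g\<in>supp. component_basis g)" for v
  proof -
    have "\<exists>c. (\<forall>g. c g \<in> A g) \<and> finite {g. c g \<noteq> 0} \<and> v = (\<Sum>g | c g \<noteq> 0. c g)"
      using grading unfolding direct_sum_def by blast
    then obtain c where "\<forall>g. c g \<in> A g" "v = (\<Sum>g | c g \<noteq> 0. c g)" by blast
    then show ?thesis using A by (auto intro!: span_sum)
  qed
  then show ?thesis by blast
qed

definition side_mult :: "bool \<Rightarrow> 'a \<Rightarrow> 'a \<Rightarrow> 'a" where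
  "side_mult s x y = (if s then x \<bullet> y else y \<bullet> x)"

lemma side_mult_zero [simp]: "side_mult s 0 y = 0" "side_mult s x 0 = 0"
  by (auto simp: side_mult_def mult_zero_left mult_zero_right)

lemma side_mult_linear:
  "side_mult s (x + x') y = side_mult s x y + side_mult s x' y"
  "side_mult s x (y + y') = side_mult s x y + side_mult s x y'"
  "side_mult s (k *s x) y = k *s side_mult s x y"
  "side_mult s x (k *s y) = k *s side_mult s x y"
  by (auto simp: side_mult_def mult_add_left mult_add_right mult_scale_left mult_scale_right)

lemma side_mult_swap: "side_mult (\<not> s) x y = side_mult s y x"
  by (simp add: side_mult_def)

lemma side_mult_span:
  assumes U: "subspace U" and XY: "\<And>x y. x \<in> X \<Longrightarrow> y \<in> Y \<Longrightarrow> side_mult s x y \<in> U"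
    and xy: "x \<in> span X" "y \<in> span Y"
  shows "side_mult s x y \<in> U"
proof -
  have right: "side_mult s x y \<in> U" if "x \<in> X" for x
    using xy(2)
    by (induction rule: span_induct_alt)
       (use U XY that in \<open>auto simp: side_mult_linear subspace_0 subspace_add subspace_scale\<close>)
  show ?thesis
    using xy(1)
    by (induction rule: span_induct_alt)
       (use U right in \<open>auto simp: side_mult_linear subspace_0 subspace_add subspace_scale\<close>)
qed

primrec act :: "(bool \<times> 'g \<times> 'a) list \<Rightarrow> 'a \<Rightarrow> 'a" where
  "act [] a = a"
| "act (l # w) a = side_mult (fst l) (act w a) (snd (snd l))"

definition words :: "nat \<Rightarrow> (bool \<times> 'g \<times> 'a) list set" where
  "words n = {w. set w \<subseteq> letters \<and> length w \<le> n}"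

lemma finite_words: "finite (words n)"
  unfolding words_def using finite_letters by (rule finite_lists_length_le)

lemma act_zero [simp]: "act w 0 = 0"
  by (induction w) auto

lemma letter_component: "l \<in> letters \<Longrightarrow> snd (snd l) \<in> A (fst (snd l))"
  using component_basis(1)[THEN subsetD] by (auto simp: letters_def)

lemma act_homogeneous:
  "a \<in> (\<Union>g. A g) \<Longrightarrow> set w \<subseteq> letters \<Longrightarrow> act w a \<in> (\<Union>g. A g)"
proof (induction w)
  case (Cons l w)
  then obtain g where "act w a \<in> A g" by auto
  moreover have "snd (snd l) \<in> A (fst (snd l))" using Cons by (intro letter_component) auto
  ultimately have "act (l # w) a \<in> A (if fst l then g * fst (snd l) else fst (snd l) * g)"
    using graded_mult by (simp add: side_mult_def)
  then show ?case by blast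
qed auto

text \<open>
  The words of bounded length applied to \<open>a\<close> span an increasing chain of homogeneous subspaces. Once two
  consecutive members coincide, the space is an ideal, hence everything. Until then the dimension
  grows with each step, so words no longer than the dimension suffice, whatever \<open>a\<close> is. This uniform
  bound is what makes the number of words in the codimension inequalities a constant.
\<close>
lemma span_words:
  assumes simple: graded_simple and a: "a \<in> A g" "a \<noteq> 0"
  shows "span ((\<lambda>w. act w a) ` words dimension) = UNIV"
proof -
  let ?W = "\<lambda>r. (\<lambda>w. act w a) ` words r"
  have hom: "?W r \<subseteq> (\<Union>g. A g)" for r
    using act_homogeneous[of a] a by (fastforce simp: words_def)
  have mono: "span (?W r) \<subseteq> span (?W (Suc r))" for r
    by (intro span_mono image_mono) (auto simp: words_def)
  have "span (?W r) = UNIV \<or> dim (?W r) > r" for r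
  proof (induction r)
    case 0
    have "?W 0 = {a}" by (auto simp: words_def)
    moreover have "independent {a}" using a by simp
    ultimately show ?case using independent_card_le_dim[of "{a}" "{a}"] by simp
  next
    case (Suc r)
    show ?case
    proof (cases "span (?W (Suc r)) = span (?W r)")
      case True
      have "side_mult s x y \<in> span (?W r)" if "x \<in> span (?W r)" for s x y
      proof (rule side_mult_span)
        show "x \<in> span (?W r)" "y \<in> span (\<Union>g\<in>supp. component_basis g)"
          using that span_letters by auto
        fix x y assume x: "x \<in> ?W r" and y: "y \<in> (\<Union>g\<in>supp. component_basis g)"
        obtain w where w: "w \<in> words r" "x = act w a" using x by blast
        obtain h where h: "(s, h, y) \<in> letters" using y by (auto simp: letters_def)
        have "side_mult s x y = act ((s, h, y) # w) a" using w by simp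
        also have "\<dots> \<in> ?W (Suc r)" using w h by (intro imageI) (auto simp: words_def)
        finally have "side_mult s x y \<in> span (?W (Suc r))" by (rule span_base)
        then show "side_mult s x y \<in> span (?W r)" by (simp only: True)
      qed simp
      from this[of _ True] this[of _ False] have "two_sided_ideal (span (?W r))"
        by (auto simp: two_sided_ideal_def side_mult_def)
      moreover have "a \<in> ?W r" by (intro image_eqI[of _ _ "[]"]) (auto simp: words_def)
      ultimately have "span (?W r) = UNIV"
        using graded_simple_span_eq_UNIV[OF simple hom] a by blast
      then show ?thesis using True by simp
    next
      case False
      then have "span (?W r) \<subset> span (?W (Suc r))" using mono by blast
      then have "dim (?W r) < dim (?W (Suc r))" by (rule dim_psubset)
      moreover have "span (?W r) \<noteq> UNIV" using False mono by blast
      ultimately show ?thesis using Suc by linarith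
    qed
  qed
  then show ?thesis using dim_subset_UNIV not_le by blast
qed

text \<open>
  A homogeneous element annihilated by all letters from both sides spans a homogeneous ideal. That
  ideal would be the whole algebra, and all products would vanish. (The annihilator of the algebra
  is no substitute: without cancellation in the semigroup it need not be homogeneous.)
\<close>
lemma exists_nonzero_letter_product:
  assumes simple: graded_simple and nz: "x0 \<bullet> y0 \<noteq> 0" and a: "a \<in> A g" "a \<noteq> 0"
  shows "\<exists>s h e. (s, h, e) \<in> letters \<and> side_mult s a e \<noteq> 0"
proof (rule ccontr)
  assume contr: "\<not> ?thesis"
  have z: "side_mult s a e = 0" if "e \<in> (\<Union>g\<in>supp. component_basis g)" for s e
    using that contr by (auto simp: letters_def)
  have ann: "side_mult s x y = 0" if "x \<in> span {a}" for s x y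
    using side_mult_span[of "{0}" "{a}" "\<Union>g\<in>supp. component_basis g" s x y] z that span_letters
    by auto
  have "two_sided_ideal (span {a})"
    using ann[of _ True] ann[of _ False] by (auto simp: two_sided_ideal_def side_mult_def span_zero)
  then have "span {a} = UNIV"
    using graded_simple_span_eq_UNIV[OF simple, of "{a}" a] a by auto
  then show False using ann[of x0 True y0] nz by (simp add: side_mult_def)
qed

text \<open>
  A graded form of primeness: some letter \<open>e\<close> does not annihilate \<open>b\<close>, and \<open>e\<close> is a combination of
  words applied to \<open>a\<close>.
\<close>
lemma exists_nonzero_word_product:
  assumes simple: graded_simple and nz: "x0 \<bullet> y0 \<noteq> 0"
    and a: "a \<in> A g" "a \<noteq> 0" and b: "b \<in> A h" "b \<noteq> 0"
  shows "\<exists>s. \<exists>w\<in>words dimension. side_mult s (act w a) b \<noteq> 0"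
proof (rule ccontr)
  assume contr: "\<not> ?thesis"
  obtain s k e where e: "side_mult s b e \<noteq> 0"
    using exists_nonzero_letter_product[OF simple nz b] by metis
  have "side_mult (\<not> s) e b \<in> {0}"
  proof (rule side_mult_span)
    show "e \<in> span ((\<lambda>w. act w a) ` words dimension)" using span_words[OF simple a] by simp
    show "b \<in> span {b}" by (simp add: span_base)
  qed (use contr in auto)
  then show False using e by (simp add: side_mult_swap)
qed

end

section \<open>Staircases\<close>

lemma sorted_wrt_product:
  assumes "sorted_wrt P xs" "sorted_wrt Q ys"
  shows "sorted_wrt (\<lambda>(x, y) (x', y'). P x x' \<or> Q y y') (List.product xs ys)"
  using assms(1)
proof (induction xs)
  case (Cons x xs)
  have "sorted_wrt (\<lambda>(x, y) (x', y'). P x x' \<or> Q y y') (map (Pair x) ys)"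
    unfolding sorted_wrt_map using assms(2) by (rule sorted_wrt_mono_rel[rotated]) auto
  then show ?case using Cons by (auto simp: sorted_wrt_append)
qed simp

lemma product_map_map: "List.product (map f xs) (map g ys) = map (map_prod f g) (List.product xs ys)"
  by (induction xs) auto

context finite_dim_graded_algebra
begin

lemma multilinear_space_finite_span:
  "\<exists>S. finite S \<and> multilinear_space \<nu> \<subseteq> free.span S"
  unfolding multilinear_space_def
  by (intro multilinear_polys_finite_span finite_SigmaI finite_supp) auto

lemma subspace_multilinear_space: "free.subspace (multilinear_space \<nu>)"
  unfolding multilinear_space_def by (rule subspace_multilinear_polys)

lemma subspace_identities: "free.subspace graded_identities"
  using two_sided_ideal_graded_identities by (simp add: free.two_sided_ideal_def)

lemma partial_codim_plus_dim:
  "partial_codim \<nu> + free.dim (multilinear_space \<nu> \<inter> graded_identities) =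
     free.dim (multilinear_space \<nu> :: ('g gvar, 'f) free_alg set)"
proof -
  obtain S :: "('g gvar, 'f) free_alg set" where "finite S" "multilinear_space \<nu> \<subseteq> free.span S"
    using multilinear_space_finite_span by blast
  then show ?thesis unfolding partial_codim_def
    by (intro free.quotient_dim_plus_dim[of _ _ S] free.subspace_inter
        subspace_multilinear_space subspace_identities) auto
qed

definition graded_subst :: "('g gvar \<Rightarrow> 'a) \<Rightarrow> bool" where
  "graded_subst \<phi> \<longleftrightarrow> (\<forall>g j. \<phi> (g, j) \<in> A g)"

abbreviation diag :: "('g gvar, 'f) free_alg \<times> ('g gvar \<Rightarrow> 'a) \<Rightarrow> 'a" where
  "diag p \<equiv> eval_poly (snd p) (fst p)"

text \<open>
  A staircase pairs polynomials with substitutions so that the matrix of values is triangular with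
  nonzero diagonal. Its length measures the number of independent polynomials modulo identities up to
  a factor, and, unlike a basis, it can be multiplied: only the diagonal values matter for that.
\<close>
definition staircase ::
  "('g \<Rightarrow> nat) \<Rightarrow> (('g gvar, 'f) free_alg \<times> ('g gvar \<Rightarrow> 'a)) list \<Rightarrow> bool" where
  "staircase \<nu> L \<longleftrightarrow>
     (\<forall>p\<in>set L. fst p \<in> multilinear_space \<nu> \<and> graded_subst (snd p) \<and> diag p \<noteq> 0) \<and>
     sorted_wrt (\<lambda>p q. eval_poly (snd p) (fst q) = 0) L"

text \<open>
  The polynomials of the staircase are independent modulo identities: each substitution cuts down the
  space of those polynomials that vanish under it and the preceding ones, and identities survive
  all cuts.
\<close>
lemma staircase_length_le:
  assumes "staircase \<nu> L"
  shows "length L \<le> partial_codim \<nu>"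
proof -
  obtain S :: "('g gvar, 'f) free_alg set" where S: "finite S" "multilinear_space \<nu> \<subseteq> free.span S"
    using multilinear_space_finite_span by blast
  have "length L + free.dim (U \<inter> graded_identities) \<le> free.dim U"
    if "free.subspace U" "U \<subseteq> multilinear_space \<nu>" "fst ` set L \<subseteq> U" for U
    using assms that
  proof (induction L arbitrary: U)
    case Nil
    obtain S where S: "finite S" "U \<subseteq> free.span S" using S Nil by blast
    have "free.quotient_dim U (U \<inter> graded_identities) + free.dim (U \<inter> graded_identities) = free.dim U"
      using S Nil by (intro free.quotient_dim_plus_dim[of _ _ S] free.subspace_inter subspace_identities) auto
    then show ?case by simp
  next
    case (Cons p L)
    obtain f \<phi> where p: "p = (f, \<phi>)" by force
    let ?W = "{u \<in> U. eval_poly \<phi> u = 0}"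
    have W: "free.subspace ?W"
      using Cons.prems(2) by (auto simp: free.subspace_def eval_poly_zero eval_poly_add eval_poly_scale)
    have f: "f \<in> U" "eval_poly \<phi> f \<noteq> 0" "graded_subst \<phi>"
      using Cons.prems p by (auto simp: staircase_def)
    have "fst ` set L \<subseteq> ?W" using Cons.prems p by (fastforce simp: staircase_def)
    moreover have "staircase \<nu> L" using Cons.prems by (auto simp: staircase_def)
    ultimately have "length L + free.dim (?W \<inter> graded_identities) \<le> free.dim ?W"
      using W Cons.prems by (intro Cons.IH) auto
    moreover have "?W \<inter> graded_identities = U \<inter> graded_identities"
      using f(3) by (auto simp: graded_identities_def graded_subst_def)
    moreover have "free.dim ?W < free.dim U"
    proof (rule free.dim_less_of_psubset)
      show "?W \<subset> U" using f by blast
      show "U \<subseteq> free.span S" using S Cons.prems by blast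
    qed (use W Cons.prems S in auto)
    ultimately show ?case by simp
  qed
  moreover have "fst ` set L \<subseteq> multilinear_space \<nu>"
    using assms by (auto simp: staircase_def)
  ultimately have "length L + free.dim (multilinear_space \<nu> \<inter> graded_identities) \<le>
      free.dim (multilinear_space \<nu> :: ('g gvar, 'f) free_alg set)"
    using subspace_multilinear_space by blast
  then show ?thesis using partial_codim_plus_dim[of \<nu>] by linarith
qed

text \<open>
  Pick a nonidentity and a substitution that detects it, pass to the polynomials vanishing under this
  substitution, and repeat. Each step costs at most the dimension of the algebra.
\<close>
lemma exists_long_staircase: "\<exists>L. staircase \<nu> L \<and> partial_codim \<nu> \<le> dimension * length L"
proof -
  obtain S :: "('g gvar, 'f) free_alg set" where S: "finite S" "multilinear_space \<nu> \<subseteq> free.span S"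
    using multilinear_space_finite_span by blast
  have "\<exists>L. staircase \<nu> L \<and> fst ` set L \<subseteq> U \<and>
      free.dim U \<le> free.dim (U \<inter> graded_identities) + dimension * length L"
    if "free.subspace U" "U \<subseteq> multilinear_space \<nu>" for U
    using that
  proof (induction "free.dim U" arbitrary: U rule: less_induct)
    case less
    show ?case
    proof (cases "U \<subseteq> graded_identities")
      case True
      then have "U \<inter> graded_identities = U" by blast
      then show ?thesis by (intro exI[of _ "[]"]) (auto simp: staircase_def)
    next
      case False
      then obtain f \<phi> where f: "f \<in> U" "graded_subst \<phi>" "eval_poly \<phi> f \<noteq> 0"
        by (auto simp: graded_identities_def graded_subst_def)
      let ?W = "{u \<in> U. eval_poly \<phi> u = 0}"
      have W: "free.subspace ?W"
        using less.prems(1) by (auto simp: free.subspace_def eval_poly_zero eval_poly_add eval_poly_scale)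
      have US: "U \<subseteq> free.span S" using S less.prems by blast
      have "free.dim ?W < free.dim U"
        by (rule free.dim_less_of_psubset[OF less.prems(1) W _ S(1) US]) (use f in blast)
      then obtain L where L: "staircase \<nu> L" "fst ` set L \<subseteq> ?W"
        "free.dim ?W \<le> free.dim (?W \<inter> graded_identities) + dimension * length L"
        using less.hyps[OF _ W] less.prems by blast
      have "?W \<inter> graded_identities = U \<inter> graded_identities"
        using f(2) by (auto simp: graded_identities_def graded_subst_def)
      moreover have "free.dim U \<le> free.dim ?W + dimension"
        by (rule dim_vanishing_at_one[OF less.prems(1) S(1) US])
      moreover have "staircase \<nu> ((f, \<phi>) # L)"
        using L f less.prems by (fastforce simp: staircase_def)
      ultimately show ?thesis using L f
        by (intro exI[of _ "(f, \<phi>) # L"]) auto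
    qed
  qed
  from this[OF subspace_multilinear_space] obtain L where "staircase \<nu> L"
    "free.dim (multilinear_space \<nu> :: ('g gvar, 'f) free_alg set) \<le>
       free.dim (multilinear_space \<nu> \<inter> graded_identities) + dimension * length L" by blast
  then show ?thesis using partial_codim_plus_dim[of \<nu>] by (intro exI[of _ L]) auto
qed

text \<open>
  Homogeneity of the diagonal values is what allows graded simplicity to be applied to them.
\<close>
lemma staircase_diag:
  assumes "staircase \<nu> L" "p \<in> set L"
  shows "diag p \<noteq> 0" "diag p \<in> (\<Union>g. A g)"
proof -
  have p: "fst p \<in> multilinear_space \<nu>" "graded_subst (snd p)" and nz: "diag p \<noteq> 0"
    using assms by (auto simp: staircase_def)
  then show "diag p \<noteq> 0" by simp
  have "Poly_Mapping.keys (fst p) \<noteq> {}" using nz by (auto simp: eval_poly_def)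
  then obtain m where m: "m \<in> Poly_Mapping.keys (fst p)" by blast
  have "eval_monomial (snd p) m' \<in> A (monomial_degree m)" if "m' \<in> Poly_Mapping.keys (fst p)" for m'
  proof -
    have "monomial_degree m' = monomial_degree m"
      using that m p(1) by (intro monomial_degree_cong) (auto simp: multilinear_space_def multilinear_polys_def)
    then show ?thesis
      using eval_monomial_in_component[of "snd p" m'] p(2) by (auto simp: graded_subst_def)
  qed
  then have "diag p \<in> A (monomial_degree m)"
    unfolding eval_poly_def
    by (intro subspace_sum subspace_scale component_subspace) auto
  then show "diag p \<in> (\<Union>g. A g)" by blast
qed

text \<open>
  The products of all pairs, in lexicographic order, form a triangular array again: the value at an
  earlier pair of substitutions has a vanishing factor. The diagonal entries are the products of the
  old ones, and those that are zero are dropped, as a triangular array stays triangular when it is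
  restricted to part of its indices.
\<close>
lemma staircase_product:
  assumes L: "staircase \<nu> L" and M: "staircase \<mu> M"
  shows "\<exists>N. staircase (\<lambda>g. \<nu> g + \<mu> g) N \<and>
    map diag N = filter (\<lambda>x. x \<noteq> 0)
      (map (\<lambda>(x, y). side_mult s x y) (List.product (map diag L) (map diag M)))"
proof -
  \<comment> \<open>The variables of the second factor are placed behind those of the first one.\<close>
  define shift :: "'g gvar \<Rightarrow> 'g gvar" where "shift = (\<lambda>(g, j). (g, \<nu> g + j))"
  define smul where "smul p q = (if s then free_mult p q else free_mult q p)"
    for p q :: "('g gvar, 'f) free_alg"
  define comb where "comb = (\<lambda>(p, q). (smul (fst p) (rename_vars shift (fst q)),
      \<lambda>(g, j). if j \<le> \<nu> g then snd p (g, j) else snd q (g, j - \<nu> g) :: 'a))"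
  define N' where "N' = map comb (List.product L M)"
  define N where "N = filter (\<lambda>r. diag r \<noteq> 0) N'"
  let ?Y = "SIGMA g:supp. {1..\<nu> g}" and ?Z = "SIGMA g:supp. {1..\<mu> g}"
  have finY: "finite ?Y" and finZ: "finite ?Z"
    using finite_supp by auto
  have inj: "inj_on shift ?Z" by (auto simp: shift_def inj_on_def)
  have disj: "?Y \<inter> shift ` ?Z = {}" by (auto simp: shift_def)
  have un: "?Y \<union> shift ` ?Z = (SIGMA g:supp. {1..\<nu> g + \<mu> g})"
  proof (intro equalityI subsetI)
    fix v assume "v \<in> (SIGMA g:supp. {1..\<nu> g + \<mu> g})"
    then obtain g j where v: "v = (g, j)" "g \<in> supp" "1 \<le> j" "j \<le> \<nu> g + \<mu> g" by auto
    show "v \<in> ?Y \<union> shift ` ?Z"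
    proof (cases "j \<le> \<nu> g")
      case False
      then show ?thesis using v by (intro UnI2 image_eqI[of _ _ "(g, j - \<nu> g)"]) (auto simp: shift_def)
    qed (use v in auto)
  qed (auto simp: shift_def)
  have memL: "fst p \<in> multilinear_polys ?Y" "graded_subst (snd p)" if "p \<in> set L" for p
    using that L by (auto simp: staircase_def multilinear_space_def)
  have memM: "fst q \<in> multilinear_polys ?Z" "graded_subst (snd q)" if "q \<in> set M" for q
    using that M by (auto simp: staircase_def multilinear_space_def)
  have mem: "fst (comb (p, q)) \<in> multilinear_space (\<lambda>g. \<nu> g + \<mu> g)" if "p \<in> set L" "q \<in> set M" for p q
  proof -
    have q: "rename_vars shift (fst q) \<in> multilinear_polys (shift ` ?Z)"
      using memM[OF that(2)] inj by (intro rename_vars_multilinear)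
    have "smul (fst p) (rename_vars shift (fst q)) \<in> multilinear_polys (?Y \<union> shift ` ?Z)"
      using free_mult_multilinear[OF memL(1)[OF that(1)] q] free_mult_multilinear[OF q memL(1)[OF that(1)]]
        finY finZ disj by (auto simp: smul_def Un_commute Int_commute)
    then show ?thesis unfolding un by (simp add: comb_def multilinear_space_def)
  qed
  have gr: "graded_subst (snd (comb (p, q)))" if "p \<in> set L" "q \<in> set M" for p q
    using memL(2)[OF that(1)] memM(2)[OF that(2)] by (auto simp: comb_def graded_subst_def)
  have ev: "eval_poly (snd (comb (p', q'))) (fst (comb (p, q))) =
      side_mult s (eval_poly (snd p') (fst p)) (eval_poly (snd q') (fst q))"
    if "p \<in> set L" "q \<in> set M" for p q p' q'
  proof -
    let ?\<chi> = "snd (comb (p', q'))"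
    have "eval_poly ?\<chi> (fst p) = eval_poly (snd p') (fst p)"
      by (rule eval_poly_cong[OF memL(1)[OF that(1)] finY]) (auto simp: comb_def)
    moreover have "eval_poly ?\<chi> (rename_vars shift (fst q)) = eval_poly (snd q') (fst q)"
      unfolding eval_poly_rename_vars
      by (rule eval_poly_cong[OF memM(1)[OF that(2)] finZ]) (auto simp: comb_def shift_def)
    moreover have "fst (comb (p, q)) = smul (fst p) (rename_vars shift (fst q))" by (simp add: comb_def)
    ultimately show ?thesis by (simp add: smul_def eval_poly_mult side_mult_def)
  qed
  have "sorted_wrt (\<lambda>x y. eval_poly (snd (comb x)) (fst (comb y)) = 0) (List.product L M)"
  proof (rule sorted_wrt_mono_rel)
    show "sorted_wrt (\<lambda>(p, q) (p', q').
        eval_poly (snd p) (fst p') = 0 \<or> eval_poly (snd q) (fst q') = 0) (List.product L M)"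
      using L M by (intro sorted_wrt_product) (auto simp: staircase_def)
    fix x y assume "x \<in> set (List.product L M)" "y \<in> set (List.product L M)"
      "(\<lambda>(p, q) (p', q'). eval_poly (snd p) (fst p') = 0 \<or> eval_poly (snd q) (fst q') = 0) x y"
    moreover obtain p q p' q' where "x = (p, q)" "y = (p', q')" by (metis surj_pair)
    ultimately have pq: "p' \<in> set L" "q' \<in> set M" "x = (p, q)" "y = (p', q')"
      "eval_poly (snd p) (fst p') = 0 \<or> eval_poly (snd q) (fst q') = 0" by (auto simp: split_beta)
    show "eval_poly (snd (comb x)) (fst (comb y)) = 0"
      using ev[OF pq(1,2), of p q] pq(3-5) by auto
  qed
  then have "sorted_wrt (\<lambda>p q. eval_poly (snd p) (fst q) = 0) N'"
    by (simp add: N'_def sorted_wrt_map)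
  then have "sorted_wrt (\<lambda>p q. eval_poly (snd p) (fst q) = 0) N"
    unfolding N_def by (rule sorted_wrt_filter)
  moreover have "\<forall>r\<in>set N. fst r \<in> multilinear_space (\<lambda>g. \<nu> g + \<mu> g) \<and> graded_subst (snd r) \<and> diag r \<noteq> 0"
  proof
    fix r assume r: "r \<in> set N"
    then obtain p q where pq: "p \<in> set L" "q \<in> set M" "r = comb (p, q)"
      unfolding N_def N'_def by auto
    have "diag r \<noteq> 0" using r by (simp add: N_def)
    then show "fst r \<in> multilinear_space (\<lambda>g. \<nu> g + \<mu> g) \<and> graded_subst (snd r) \<and> diag r \<noteq> 0"
      using mem[OF pq(1,2)] gr[OF pq(1,2)] pq(3) by simp
  qed
  ultimately have "staircase (\<lambda>g. \<nu> g + \<mu> g) N" by (simp add: staircase_def)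
  moreover have "map diag N' = map (\<lambda>(x, y). side_mult s x y) (List.product (map diag L) (map diag M))"
    unfolding N'_def product_map_map map_map using ev by (intro map_cong refl) auto
  then have "map diag N = filter (\<lambda>x. x \<noteq> 0)
      (map (\<lambda>(x, y). side_mult s x y) (List.product (map diag L) (map diag M)))"
    unfolding N_def by (metis (no_types, lifting) comp_apply filter_cong filter_map)
  ultimately show ?thesis by blast
qed

lemma letter_staircase:
  assumes "(g, e) \<in> (SIGMA g:supp. component_basis g)"
  shows "\<exists>N. staircase (\<lambda>h. if h = g then 1 else 0) N \<and> map diag N = [e]"
proof -
  define \<phi> where "\<phi> v = (if v = (g, 1) then e else 0)" for v :: "'g gvar"
  have e: "e \<in> A g" "e \<noteq> 0" and g: "g \<in> supp"
    using assms component_basis(1)[of g] component_basis_nonzero[of g] by auto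
  have "(SIGMA h:supp. {1..if h = g then 1 else 0 :: nat}) = {(g, 1)}"
    using g by (auto split: if_splits)
  then have "Poly_Mapping.single (Var (g, 1)) 1 \<in> multilinear_space (\<lambda>h. if h = g then 1 else 0)"
    by (auto simp: multilinear_space_def multilinear_polys_def)
  moreover have "graded_subst \<phi>" using e component_zero by (auto simp: graded_subst_def \<phi>_def)
  ultimately show ?thesis using e
    by (intro exI[of _ "[(Poly_Mapping.single (Var (g, 1)) 1, \<phi>)]"])
       (auto simp: staircase_def eval_poly_single \<phi>_def)
qed

definition word_degrees :: "(bool \<times> 'g \<times> 'a) list \<Rightarrow> 'g list" where
  "word_degrees w = map (\<lambda>l. fst (snd l)) w"

lemma filter_nonzero_map_filter:
  "h 0 = 0 \<Longrightarrow> filter (\<lambda>x. x \<noteq> 0) (map h (filter (\<lambda>x. x \<noteq> (0::'a)) xs)) = filter (\<lambda>x. x \<noteq> (0::'a)) (map h xs)"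
  by (induction xs) auto

text \<open>
  A basis element is the value of a single variable, that is, of a staircase of length one. Multiplying by
  the letters of a word one by one thus realises the word, with a fresh variable for each letter.
\<close>
lemma staircase_word:
  assumes L: "staircase \<nu> L" and w: "set w \<subseteq> letters"
  shows "\<exists>N. staircase (\<lambda>g. \<nu> g + count (mset (word_degrees w)) g) N \<and>
    map diag N = filter (\<lambda>x. x \<noteq> 0) (map (act w) (map diag L))"
  using w
proof (induction w)
  case Nil
  have "filter (\<lambda>x. x \<noteq> 0) (map diag L) = map diag L"
    using staircase_diag(1)[OF L] by (intro filter_True) auto
  then show ?case using L by (intro exI[of _ L]) (simp add: word_degrees_def)
next
  case (Cons l w)
  obtain s g e where l: "l = (s, g, e)" by (metis surj_pair)
  obtain N where N: "staircase (\<lambda>g. \<nu> g + count (mset (word_degrees w)) g) N"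
    "map diag N = filter (\<lambda>x. x \<noteq> 0) (map (act w) (map diag L))"
    using Cons by auto
  obtain M where M: "staircase (\<lambda>h. if h = g then 1 else 0) M" "map diag M = [e]"
    using letter_staircase[of g e] Cons.prems l by (auto simp: letters_def)
  obtain N' where N': "staircase (\<lambda>h. \<nu> h + count (mset (word_degrees w)) h + (if h = g then 1 else 0)) N'"
    "map diag N' = filter (\<lambda>x. x \<noteq> 0)
      (map (\<lambda>(x, y). side_mult s x y) (List.product (map diag N) (map diag M)))"
    using staircase_product[OF N(1) M(1), of s] by blast
  have single: "map (\<lambda>(x, y). side_mult s x y) (List.product xs [e]) = map (\<lambda>x. side_mult s x e) xs" for xs
    by (induction xs) auto
  have "map diag N' = filter (\<lambda>x. x \<noteq> 0) (map (act (l # w)) (map diag L))"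
    unfolding N'(2) M(2) single N(2)
    by (subst filter_nonzero_map_filter) (simp_all add: l comp_def)
  moreover have "(\<lambda>h. \<nu> h + count (mset (word_degrees w)) h + (if h = g then 1 else 0)) =
      (\<lambda>h. \<nu> h + count (mset (word_degrees (l # w))) h)"
    by (auto simp: word_degrees_def l)
  ultimately show ?case using N'(1) by metis
qed

end

section \<open>Inequalities between codimensions\<close>

text \<open>
  The pigeonhole principle for a list whose members each satisfy one of finitely many conditions.
\<close>
lemma length_le_sum_length_filter:
  assumes "finite W" "\<And>x. x \<in> set xs \<Longrightarrow> \<exists>w\<in>W. P w x"
  shows "length xs \<le> (\<Sum>w\<in>W. length (filter (P w) xs))"
  using assms(2)
proof (induction xs)
  case (Cons x xs)
  then obtain w0 where w0: "w0 \<in> W" "P w0 x" by auto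
  have "1 \<le> (\<Sum>w\<in>W. if P w x then 1 else 0 :: nat)"
    using member_le_sum[of w0 W "\<lambda>w. if P w x then 1 else 0 :: nat"] w0 assms(1) by simp
  moreover have "(\<Sum>w\<in>W. length (filter (P w) (x # xs))) =
      (\<Sum>w\<in>W. if P w x then 1 else 0) + (\<Sum>w\<in>W. length (filter (P w) xs))"
    unfolding sum.distrib[symmetric] by (intro sum.cong) auto
  ultimately show ?case using Cons by fastforce
qed simp

context finite_dim_graded_algebra
begin

definition codim :: "'g list \<Rightarrow> nat" where
  "codim hs = partial_codim (count (mset hs))"

text \<open>
  Lists of degrees unfold the multinomial coefficients: a tuple \<open>\<nu>\<close> of the sum defining the graded
  codimension has as many arrangements as its coefficient says. With lists, concatenation takes the
  place of Vandermonde identities.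
\<close>
definition degree_lists :: "nat \<Rightarrow> 'g list set" where
  "degree_lists n = {hs. set hs \<subseteq> supp \<and> length hs = n}"

lemma finite_degree_lists: "finite (degree_lists n)"
  unfolding degree_lists_def using finite_supp by (rule finite_lists_length_eq)

lemma word_degrees_in_supp: "w \<in> words n \<Longrightarrow> set (word_degrees w) \<subseteq> supp"
  by (force simp: words_def word_degrees_def letters_def)

lemma graded_codim_eq: "graded_codim n = (\<Sum>hs\<in>degree_lists n. codim hs)"
proof -
  have fiber: "{hs \<in> degree_lists n. count (mset hs) = \<nu>} = permutations_of_multiset (Abs_multiset \<nu>)
      \<and> card (permutations_of_multiset (Abs_multiset \<nu>)) = fact n div (\<Prod>g\<in>supp. fact (\<nu> g))"
    if "\<nu> \<in> compositions n" for \<nu>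
  proof -
    have \<nu>: "\<And>g. g \<notin> supp \<Longrightarrow> \<nu> g = 0" "(\<Sum>g\<in>supp. \<nu> g) = n"
      using that by (auto simp: compositions_def)
    define X where "X = Abs_multiset \<nu>"
    have "{g. \<nu> g > 0} \<subseteq> supp" using \<nu>(1) by force
    then have X: "count X = \<nu>"
      unfolding X_def using finite_supp by (intro count_Abs_multiset) (rule finite_subset)
    have sub: "set_mset X \<subseteq> supp" using \<nu>(1) by (auto simp: set_mset_def X intro: ccontr)
    have "size X = (\<Sum>g\<in>supp. \<nu> g)"
      unfolding size_multiset_overloaded_eq X[symmetric]
      using sub finite_supp by (intro sum.mono_neutral_left) (auto simp: not_in_iff)
    then have size: "size X = n" using \<nu> by simp
    have "(\<Prod>g\<in>set_mset X. fact (count X g)) = (\<Prod>g\<in>supp. fact (\<nu> g) :: nat)"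
      unfolding X[symmetric]
      using sub finite_supp by (intro prod.mono_neutral_left) (auto simp: not_in_iff)
    then have "card (permutations_of_multiset X) = fact n div (\<Prod>g\<in>supp. fact (\<nu> g))"
      by (simp add: card_permutations_of_multiset size)
    moreover have "mset hs = X \<longleftrightarrow> count (mset hs) = \<nu>" for hs
      using X by (metis multiset_eqI)
    moreover have "hs \<in> degree_lists n" if "mset hs = X" for hs
      unfolding degree_lists_def using sub size that
      by (metis (mono_tags, lifting) mem_Collect_eq set_mset_mset size_mset)
    ultimately have "{hs \<in> degree_lists n. count (mset hs) = \<nu>} = permutations_of_multiset X \<and>
        card (permutations_of_multiset X) = fact n div (\<Prod>g\<in>supp. fact (\<nu> g))"
      by (auto simp: permutations_of_multiset_def)
    then show ?thesis by (simp add: X_def)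
  qed
  have image: "(\<lambda>hs. count (mset hs)) ` degree_lists n = compositions n"
  proof (intro equalityI subsetI)
    fix \<nu> assume "\<nu> \<in> (\<lambda>hs. count (mset hs)) ` degree_lists n"
    then obtain hs where hs: "\<nu> = count (mset hs)" "set hs \<subseteq> supp" "length hs = n"
      by (auto simp: degree_lists_def)
    have "n = (\<Sum>g\<in>set hs. count (mset hs) g)"
      using size_multiset_overloaded_eq[of "mset hs"] hs by simp
    also have "\<dots> = (\<Sum>g\<in>supp. count (mset hs) g)"
      using hs finite_supp by (intro sum.mono_neutral_left) (auto simp: count_mset_0_iff)
    finally show "\<nu> \<in> compositions n" using hs by (auto simp: compositions_def count_mset_0_iff)
  next
    fix \<nu> assume \<nu>: "\<nu> \<in> compositions n"
    obtain hs where "hs \<in> permutations_of_multiset (Abs_multiset \<nu>)"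
      by (metis ex_mset permutations_of_multisetI)
    then have "hs \<in> {hs \<in> degree_lists n. count (mset hs) = \<nu>}" using fiber[OF \<nu>] by simp
    then show "\<nu> \<in> (\<lambda>hs. count (mset hs)) ` degree_lists n" by blast
  qed
  have fin: "finite (compositions n)" unfolding image[symmetric] using finite_degree_lists by (rule finite_imageI)
  have "(\<Sum>hs\<in>degree_lists n. codim hs) =
      (\<Sum>\<nu>\<in>compositions n. \<Sum>hs\<in>{hs \<in> degree_lists n. count (mset hs) = \<nu>}. codim hs)"
    using image by (intro sum.group[symmetric] finite_degree_lists fin) auto
  also have "\<dots> = (\<Sum>\<nu>\<in>compositions n. (fact n div (\<Prod>g\<in>supp. fact (\<nu> g))) * partial_codim \<nu>)"
  proof (intro sum.cong refl)
    fix \<nu> assume \<nu>: "\<nu> \<in> compositions n"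
    have "(\<Sum>hs\<in>{hs \<in> degree_lists n. count (mset hs) = \<nu>}. codim hs) =
        (\<Sum>hs\<in>{hs \<in> degree_lists n. count (mset hs) = \<nu>}. partial_codim \<nu>)"
      by (intro sum.cong) (auto simp: codim_def)
    then show "(\<Sum>hs\<in>{hs \<in> degree_lists n. count (mset hs) = \<nu>}. codim hs) =
        (fact n div (\<Prod>g\<in>supp. fact (\<nu> g))) * partial_codim \<nu>"
      using fiber[OF \<nu>] by simp
  qed
  finally show ?thesis by (simp add: graded_codim_def)
qed

lemma length_filter_product_act:
  "length (filter (\<lambda>x. x \<noteq> 0) (map (\<lambda>(x, y). side_mult s x y)
      (List.product (filter (\<lambda>x. x \<noteq> 0) (map (act w) xs)) ys))) =
   length (filter (\<lambda>(x, y). side_mult s (act w x) y \<noteq> 0) (List.product xs ys))"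
proof (induction xs)
  case (Cons x xs)
  have "filter ((\<lambda>x. x \<noteq> 0) \<circ> (\<lambda>(x, y). side_mult s x y) \<circ> Pair (act w x)) ys =
      filter (\<lambda>y. side_mult s (act w x) y \<noteq> 0) ys"
    by (simp add: comp_def)
  moreover have "filter (\<lambda>(x, y). side_mult s (act w x) y \<noteq> 0) (map (Pair x) ys) =
      map (Pair x) (filter (\<lambda>y. side_mult s (act w x) y \<noteq> 0) ys)"
    by (induction ys) auto
  ultimately show ?case using Cons by auto
qed simp

text \<open>
  Multiply long staircases for the two lists of degrees. Every pair of diagonal values has a nonzero product
  after some word is applied to the first one, so the staircases obtained for the
  finitely many words together contain all pairs.
\<close>
lemma codim_mult_le:
  assumes simple: graded_simple and nz: "x0 \<bullet> y0 \<noteq> 0"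
  shows "codim hs * codim hs' \<le> dimension ^ 2 *
    (\<Sum>(s, w)\<in>(UNIV :: bool set) \<times> words dimension. codim (hs @ hs' @ word_degrees w))"
proof -
  obtain L where L: "staircase (count (mset hs)) L" "codim hs \<le> dimension * length L"
    using exists_long_staircase codim_def by metis
  obtain M where M: "staircase (count (mset hs')) M" "codim hs' \<le> dimension * length M"
    using exists_long_staircase codim_def by metis
  define Z where "Z = List.product (map diag L) (map diag M)"
  define P where "P = (\<lambda>(s, w) (x, y). side_mult s (act w x) y \<noteq> 0)"
  have "\<exists>r\<in>(UNIV :: bool set) \<times> words dimension. P r z" if "z \<in> set Z" for z
  proof -
    have "z \<in> diag ` set L \<times> diag ` set M" using that by (simp add: Z_def)
    then obtain p q where pq: "p \<in> set L" "q \<in> set M" "z = (diag p, diag q)" by blast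
    obtain g h where "diag p \<in> A g" "diag q \<in> A h"
      using staircase_diag(2)[OF L(1) pq(1)] staircase_diag(2)[OF M(1) pq(2)] by blast
    then obtain s w where "w \<in> words dimension" "side_mult s (act w (diag p)) (diag q) \<noteq> 0"
      using exists_nonzero_word_product[OF simple nz, of "diag p" g "diag q" h]
        staircase_diag(1)[OF L(1) pq(1)] staircase_diag(1)[OF M(1) pq(2)] by blast
    then show ?thesis using pq by (intro bexI[of _ "(s, w)"]) (auto simp: P_def)
  qed
  then have "length Z \<le> (\<Sum>r\<in>(UNIV :: bool set) \<times> words dimension. length (filter (P r) Z))"
    using finite_words by (intro length_le_sum_length_filter) auto
  also have "\<dots> \<le> (\<Sum>(s, w)\<in>(UNIV :: bool set) \<times> words dimension. codim (hs @ hs' @ word_degrees w))"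
  proof (rule sum_mono)
    fix r assume "r \<in> (UNIV :: bool set) \<times> words dimension"
    then obtain s w where r: "r = (s, w)" and w: "set w \<subseteq> letters" by (auto simp: words_def)
    obtain N where N: "staircase (\<lambda>g. count (mset hs) g + count (mset (word_degrees w)) g) N"
      "map diag N = filter (\<lambda>x. x \<noteq> 0) (map (act w) (map diag L))"
      using staircase_word[OF L(1) w] by blast
    obtain N' where N': "staircase (\<lambda>g. count (mset hs) g + count (mset (word_degrees w)) g + count (mset hs') g) N'"
      "map diag N' = filter (\<lambda>x. x \<noteq> 0)
        (map (\<lambda>(x, y). side_mult s x y) (List.product (map diag N) (map diag M)))"
      using staircase_product[OF N(1) M(1), of s] by blast
    have "length (filter (P (s, w)) Z) = length (map diag N')"
      unfolding N'(2) N(2) length_filter_product_act by (simp add: P_def Z_def)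
    also have "\<dots> \<le> partial_codim (\<lambda>g. count (mset hs) g + count (mset (word_degrees w)) g + count (mset hs') g)"
      using staircase_length_le[OF N'(1)] by simp
    also have "(\<lambda>g. count (mset hs) g + count (mset (word_degrees w)) g + count (mset hs') g) =
        count (mset (hs @ hs' @ word_degrees w))"
      by (auto simp: fun_eq_iff)
    finally show "length (filter (P r) Z) \<le> (case r of (s, w) \<Rightarrow> codim (hs @ hs' @ word_degrees w))"
      unfolding codim_def r prod.case .
  qed
  finally have "length L * length M \<le> (\<Sum>(s, w)\<in>(UNIV :: bool set) \<times> words dimension. codim (hs @ hs' @ word_degrees w))"
    by (simp add: Z_def)
  then have "dimension ^ 2 * (length L * length M) \<le> dimension ^ 2 *
    (\<Sum>(s, w)\<in>(UNIV :: bool set) \<times> words dimension. codim (hs @ hs' @ word_degrees w))" by (rule mult_left_mono) simp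
  moreover have "codim hs * codim hs' \<le> dimension ^ 2 * (length L * length M)"
    using mult_mono[OF L(2) M(2)] by (simp add: power2_eq_square mult_ac)
  ultimately show ?thesis by linarith
qed

text \<open>
  The same argument with a single letter bounds a codimension by those in one degree more, so that
  the different lengths of words can be evened out later.
\<close>
lemma codim_le_letters:
  assumes simple: graded_simple and nz: "x0 \<bullet> y0 \<noteq> 0"
  shows "codim hs \<le> dimension * (\<Sum>l\<in>letters. codim (hs @ word_degrees [l]))"
proof -
  obtain L where L: "staircase (count (mset hs)) L" "codim hs \<le> dimension * length L"
    using exists_long_staircase codim_def by metis
  have "\<exists>l\<in>letters. act [l] x \<noteq> 0" if "x \<in> set (map diag L)" for x
  proof -
    have "x \<in> diag ` set L" using that by simp
    then obtain g where "x \<in> A g" "x \<noteq> 0" using staircase_diag[OF L(1)] by blast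
    then obtain s h e where "(s, h, e) \<in> letters" "side_mult s x e \<noteq> 0"
      using exists_nonzero_letter_product[OF simple nz] by blast
    then show ?thesis by (intro bexI[of _ "(s, h, e)"]) auto
  qed
  then have "length (map diag L) \<le> (\<Sum>l\<in>letters. length (filter (\<lambda>x. act [l] x \<noteq> 0) (map diag L)))"
    using finite_letters by (intro length_le_sum_length_filter)
  also have "\<dots> \<le> (\<Sum>l\<in>letters. codim (hs @ word_degrees [l]))"
  proof (intro sum_mono)
    fix l assume "l \<in> letters"
    then obtain N where N: "staircase (\<lambda>g. count (mset hs) g + count (mset (word_degrees [l])) g) N"
      "map diag N = filter (\<lambda>x. x \<noteq> 0) (map (act [l]) (map diag L))"
      using staircase_word[OF L(1), of "[l]"] by auto
    have "length (filter (\<lambda>x. act [l] x \<noteq> 0) (map diag L)) = length (map diag N)"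
      unfolding N(2) filter_map[of _ "act [l]"] by (simp add: comp_def)
    also have "\<dots> \<le> partial_codim (\<lambda>g. count (mset hs) g + count (mset (word_degrees [l])) g)"
      using staircase_length_le[OF N(1)] by simp
    also have "(\<lambda>g. count (mset hs) g + count (mset (word_degrees [l])) g) = count (mset (hs @ word_degrees [l]))"
      by (auto simp: fun_eq_iff)
    finally show "length (filter (\<lambda>x. act [l] x \<noteq> 0) (map diag L)) \<le> codim (hs @ word_degrees [l])"
      unfolding codim_def .
  qed
  finally have "dimension * length L \<le> dimension * (\<Sum>l\<in>letters. codim (hs @ word_degrees [l]))"
    by simp
  then show ?thesis using L(2) by linarith
qed

lemma sum_codim_le_graded_codim:
  assumes "inj_on f X" "f ` X \<subseteq> degree_lists n"
  shows "(\<Sum>x\<in>X. codim (f x)) \<le> graded_codim n"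
proof -
  have "(\<Sum>x\<in>X. codim (f x)) = (\<Sum>hs\<in>f ` X. codim hs)"
    using assms by (simp add: sum.reindex)
  also have "\<dots> \<le> graded_codim n"
    unfolding graded_codim_eq using assms by (intro sum_mono2 finite_degree_lists) auto
  finally show ?thesis .
qed

text \<open>
  Appending a fixed degree is injective on lists of degrees, so the bound for lists sums up to one for the
  graded codimensions.
\<close>
lemma graded_codim_Suc:
  assumes simple: graded_simple and nz: "x0 \<bullet> y0 \<noteq> 0"
  shows "graded_codim n \<le> dimension * card letters * graded_codim (Suc n)"
proof -
  have "graded_codim n \<le> (\<Sum>hs\<in>degree_lists n. dimension * (\<Sum>l\<in>letters. codim (hs @ word_degrees [l])))"
    unfolding graded_codim_eq by (intro sum_mono codim_le_letters[OF simple nz])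
  also have "\<dots> = dimension * (\<Sum>l\<in>letters. \<Sum>hs\<in>degree_lists n. codim (hs @ word_degrees [l]))"
    unfolding sum_distrib_left by (rule sum.swap)
  also have "\<dots> \<le> dimension * (\<Sum>l\<in>letters. graded_codim (Suc n))"
  proof (intro mult_left_mono sum_mono)
    fix l assume "l \<in> letters"
    then have "fst (snd l) \<in> supp" by (auto simp: letters_def)
    then show "(\<Sum>hs\<in>degree_lists n. codim (hs @ word_degrees [l])) \<le> graded_codim (Suc n)"
      by (intro sum_codim_le_graded_codim) (auto simp: inj_on_def degree_lists_def word_degrees_def)
  qed simp
  finally show ?thesis by simp
qed

text \<open>
  Summing over pairs of lists works because a pair of lists of given lengths is recovered from the
  concatenation. The words have different lengths; the one-step inequality pads all of them to the
  dimension, at the price of a constant.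
\<close>
lemma graded_codim_supermultiplicative:
  assumes simple: graded_simple and nz: "x0 \<bullet> y0 \<noteq> 0"
  shows "\<exists>K. \<forall>m n. graded_codim m * graded_codim n \<le> K * graded_codim (m + n + dimension)"
proof -
  \<comment> \<open>At least 1, so that its powers increase.\<close>
  define K1 where "K1 = Suc (dimension * card letters)"
  have step: "graded_codim n \<le> K1 * graded_codim (Suc n)" for n
    using graded_codim_Suc[OF simple nz, of n] by (simp add: K1_def)
  have steps: "graded_codim n \<le> K1 ^ k * graded_codim (n + k)" for n k
  proof (induction k)
    case (Suc k)
    have "K1 ^ k * graded_codim (n + k) \<le> K1 ^ k * (K1 * graded_codim (Suc (n + k)))"
      by (intro mult_left_mono step) simp
    also have "\<dots> = K1 ^ Suc k * graded_codim (n + Suc k)" by (simp add: mult_ac)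
    finally show ?case using Suc.IH by linarith
  qed simp
  let ?R = "(UNIV :: bool set) \<times> words dimension"
  have "graded_codim m * graded_codim n \<le>
      dimension ^ 2 * card ?R * K1 ^ dimension * graded_codim (m + n + dimension)" for m n
  proof -
    have "graded_codim m * graded_codim n =
        (\<Sum>(hs, hs')\<in>degree_lists m \<times> degree_lists n. codim hs * codim hs')"
      unfolding graded_codim_eq sum_product sum.cartesian_product ..
    also have "\<dots> \<le> (\<Sum>(hs, hs')\<in>degree_lists m \<times> degree_lists n.
        dimension ^ 2 * (\<Sum>(s, w)\<in>?R. codim (hs @ hs' @ word_degrees w)))"
      by (intro sum_mono) (use codim_mult_le[OF simple nz] in auto)
    also have "\<dots> = dimension ^ 2 * (\<Sum>(s, w)\<in>?R.
        \<Sum>(hs, hs')\<in>degree_lists m \<times> degree_lists n. codim (hs @ hs' @ word_degrees w))"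
      unfolding split_beta sum_distrib_left[symmetric] by (subst sum.swap) simp
    also have "\<dots> \<le> dimension ^ 2 * (\<Sum>(s, w)\<in>?R. K1 ^ dimension * graded_codim (m + n + dimension))"
    proof (intro mult_left_mono sum_mono, clarify)
      fix s w assume w: "w \<in> words dimension"
      then have len: "length w \<le> dimension" by (simp add: words_def)
      have lenw: "length (word_degrees w) = length w" by (simp add: word_degrees_def)
      have "(\<Sum>(hs, hs')\<in>degree_lists m \<times> degree_lists n. codim (hs @ hs' @ word_degrees w)) \<le>
          graded_codim (m + n + length w)"
        unfolding split_beta using word_degrees_in_supp[OF w] lenw
        by (intro sum_codim_le_graded_codim) (auto simp: inj_on_def degree_lists_def dest: subsetD)
      also have "\<dots> \<le> K1 ^ (dimension - length w) * graded_codim (m + n + length w + (dimension - length w))"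
        by (rule steps)
      also have "m + n + length w + (dimension - length w) = m + n + dimension" using len by simp
      also have "K1 ^ (dimension - length w) * graded_codim (m + n + dimension) \<le>
          K1 ^ dimension * graded_codim (m + n + dimension)"
        by (intro mult_right_mono power_increasing) (auto simp: K1_def)
      finally show "(\<Sum>(hs, hs')\<in>degree_lists m \<times> degree_lists n. codim (hs @ hs' @ word_degrees w)) \<le>
        K1 ^ dimension * graded_codim (m + n + dimension)" .
    qed simp
    also have "\<dots> = dimension ^ 2 * card ?R * K1 ^ dimension * graded_codim (m + n + dimension)"
      by (simp add: split_beta)
    finally show ?thesis .
  qed
  then show ?thesis by blast
qed

lemma graded_codim_pos:
  assumes simple: graded_simple and nz: "x0 \<bullet> y0 \<noteq> 0" and n: "n > 0"
  shows "graded_codim n > 0"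
  using n
proof (induction n rule: nat_induct_non_zero)
  case 1
  have "(\<Union>g\<in>supp. component_basis g) \<noteq> {}"
  proof
    assume "(\<Union>g\<in>supp. component_basis g) = {}"
    then have "x0 = 0" using span_letters by (metis UNIV_I empty_iff insert_iff span_empty)
    then show False using nz by (simp add: mult_zero_left)
  qed
  then obtain g e where ge: "g \<in> supp" "e \<in> component_basis g" by blast
  obtain N where N: "staircase (\<lambda>h. if h = g then 1 else 0) N" "map diag N = [e]"
    using letter_staircase[of g e] ge by auto
  have "1 = length (map diag N)" using N by simp
  also have "\<dots> \<le> partial_codim (\<lambda>h. if h = g then 1 else 0)"
    using staircase_length_le[OF N(1)] by simp
  also have "(\<lambda>h. if h = g then 1 else 0) = count (mset [g])" by auto
  finally have "1 \<le> codim [g]" unfolding codim_def .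
  also have "codim [g] \<le> graded_codim 1"
    using sum_codim_le_graded_codim[of id "{[g]}" 1] ge by (simp add: degree_lists_def)
  finally show ?case by simp
next
  case (Suc n)
  then show ?case using graded_codim_Suc[OF simple nz, of n] by (cases "graded_codim (Suc n)") auto
qed

text \<open>
  Multilinearity reduces identities to substitutions of basis elements. The induction replaces basis
  elements by arbitrary elements for one variable after the other.
\<close>
lemma multilinear_identity_if_vanishing_on_basis:
  fixes f :: "('g gvar, 'f) free_alg"
  defines "Y \<equiv> \<lambda>\<nu>. SIGMA g:supp. {1..\<nu> g :: nat}"
  assumes f: "f \<in> multilinear_space \<nu>"
    and basis: "\<And>\<psi>. \<psi> \<in> Pi\<^sub>E (Y \<nu>) (\<lambda>v. component_basis (fst v)) \<Longrightarrow>
      eval_poly (\<lambda>v. if v \<in> Y \<nu> then \<psi> v else 0) f = 0"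
  shows "f \<in> graded_identities"
proof -
  have fY: "f \<in> multilinear_polys (Y \<nu>)" using f by (simp add: multilinear_space_def Y_def)
  have finY: "finite (Y \<nu>)" unfolding Y_def using finite_supp by auto
  have "eval_poly \<phi> f = 0"
    if "finite Z" "Z \<subseteq> Y \<nu>" "graded_subst \<phi>" "\<And>y. y \<in> Y \<nu> - Z \<Longrightarrow> \<phi> y \<in> component_basis (fst y)" for Z \<phi>
    using that
  proof (induction Z arbitrary: \<phi>)
    case empty
    have "eval_poly \<phi> f = eval_poly (\<lambda>v. if v \<in> Y \<nu> then restrict \<phi> (Y \<nu>) v else 0) f"
      by (rule eval_poly_cong[OF fY finY]) auto
    also have "\<dots> = 0" using empty by (intro basis) auto
    finally show ?case .
  next
    case (insert y Z)
    obtain g j where y: "y = (g, j)" by force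
    have "\<phi> y \<in> span (component_basis g)"
      using insert.prems(2) component_basis(3)[of g] y by (auto simp: graded_subst_def)
    then obtain r where r: "\<phi> y = (\<Sum>b\<in>component_basis g. r b *s b)"
      unfolding span_finite[OF finite_component_basis] by blast
    have "eval_poly \<phi> f = eval_poly (\<phi>(y := \<Sum>b\<in>component_basis g. r b *s b)) f"
      unfolding r[symmetric] by simp
    also have "\<dots> = (\<Sum>b\<in>component_basis g. r b *s eval_poly (\<phi>(y := b)) f)"
      using insert.prems finY finite_component_basis by (intro eval_poly_linear[OF fY]) auto
    also have "\<dots> = (\<Sum>b\<in>component_basis g. r b *s 0)"
    proof (intro sum.cong refl arg_cong2[where f=scale])
      fix b assume b: "b \<in> component_basis g"
      then have "b \<in> A g" using component_basis(1) by blast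
      then have graded: "graded_subst (\<phi>(y := b))"
        using insert.prems(2) y by (auto simp: graded_subst_def)
      have basis: "(\<phi>(y := b)) z \<in> component_basis (fst z)" if "z \<in> Y \<nu> - Z" for z
        using that b insert.prems(3)[of z] y by auto
      show "eval_poly (\<phi>(y := b)) f = 0"
        by (rule insert.IH[OF _ graded basis]) (use insert.prems in auto)
    qed
    finally show ?case by simp
  qed
  from this[OF finY] show ?thesis by (auto simp: graded_identities_def graded_subst_def)
qed

text \<open>
  A polynomial of degree \<open>n\<close> is determined modulo identities by its values at the substitutions of
  basis elements, of which there are exponentially many in \<open>n\<close>.
\<close>
lemma partial_codim_le:
  "partial_codim \<nu> \<le> dimension * dimension ^ (\<Sum>g\<in>supp. \<nu> g)"
proof -
  let ?Y = "SIGMA g:supp. {1..\<nu> g}"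
  let ?E = "Pi\<^sub>E ?Y (\<lambda>v. component_basis (fst v))"
  let ?V = "multilinear_space \<nu> :: ('g gvar, 'f) free_alg set"
  define \<Phi> where "\<Phi> = (\<lambda>\<psi> v. if v \<in> ?Y then \<psi> v else 0) ` ?E"
  have finY: "finite ?Y" using finite_supp by auto
  have finE: "finite ?E" using finY finite_component_basis by (intro finite_PiE) auto
  have "card \<Phi> \<le> card ?E" unfolding \<Phi>_def using finE by (rule card_image_le)
  also have "\<dots> = (\<Prod>v\<in>?Y. card (component_basis (fst v)))" using finY by (rule card_PiE)
  also have "\<dots> \<le> (\<Prod>v\<in>?Y. dimension)" by (intro prod_mono) (auto intro: card_component_basis)
  also have "\<dots> = dimension ^ (\<Sum>g\<in>supp. \<nu> g)" using finite_supp by (simp add: card_SigmaI)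
  finally have card: "card \<Phi> \<le> dimension ^ (\<Sum>g\<in>supp. \<nu> g)" .
  have graded: "graded_subst \<phi>" if "\<phi> \<in> \<Phi>" for \<phi>
    using that component_basis(1) component_zero
    by (fastforce simp: graded_subst_def \<Phi>_def PiE_def Pi_def)
  have "u \<in> graded_identities" if "u \<in> ?V" "\<forall>\<phi>\<in>\<Phi>. eval_poly \<phi> u = 0" for u
    using that by (intro multilinear_identity_if_vanishing_on_basis) (auto simp: \<Phi>_def)
  moreover have "eval_poly \<phi> u = 0" if "u \<in> graded_identities" "\<phi> \<in> \<Phi>" for u \<phi>
    using that graded by (auto simp: graded_identities_def graded_subst_def)
  ultimately have "{u \<in> ?V. \<forall>\<phi>\<in>\<Phi>. eval_poly \<phi> u = 0} = ?V \<inter> graded_identities" by blast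
  moreover obtain S :: "('g gvar, 'f) free_alg set" where "finite S" "?V \<subseteq> free.span S"
    using multilinear_space_finite_span by blast
  moreover have "finite \<Phi>" unfolding \<Phi>_def using finE by (rule finite_imageI)
  ultimately have "free.dim ?V \<le> free.dim (?V \<inter> graded_identities) + dimension * card \<Phi>"
    using dim_vanishing_on[OF subspace_multilinear_space, of S \<nu> \<Phi>] by simp
  moreover have "dimension * card \<Phi> \<le> dimension * dimension ^ (\<Sum>g\<in>supp. \<nu> g)"
    using card by (rule mult_left_mono) simp
  ultimately show ?thesis using partial_codim_plus_dim[of \<nu>] by linarith
qed

lemma graded_codim_le: "graded_codim n \<le> dimension * (card supp * dimension) ^ n"
proof -
  have "codim hs \<le> dimension * dimension ^ n" if hs: "hs \<in> degree_lists n" for hs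
  proof -
    have "(\<Sum>g\<in>supp. count (mset hs) g) = (\<Sum>g\<in>set hs. count (mset hs) g)"
      using hs finite_supp by (intro sum.mono_neutral_right) (auto simp: count_mset_0_iff degree_lists_def)
    also have "\<dots> = n" using size_multiset_overloaded_eq[of "mset hs"] hs by (simp add: degree_lists_def)
    finally show ?thesis using partial_codim_le[of "count (mset hs)"] by (simp add: codim_def)
  qed
  then have "graded_codim n \<le> (\<Sum>hs\<in>degree_lists n. dimension * dimension ^ n)"
    unfolding graded_codim_eq by (intro sum_mono)
  also have "\<dots> = dimension * (card supp * dimension) ^ n"
    using finite_supp by (simp add: degree_lists_def card_lists_length_eq power_mult_distrib)
  finally show ?thesis .
qed

text \<open>
  Graded simplicity does not exclude zero multiplication. Then all monomials of degree at
  least 2 are identities, and the limit is 0.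
\<close>
lemma graded_codim_eq_0:
  assumes zero: "\<And>x y. x \<bullet> y = 0" and n: "n \<ge> 2"
  shows "graded_codim n = 0"
proof -
  have "codim hs = 0" if hs: "hs \<in> degree_lists n" for hs
  proof -
    obtain L where L: "staircase (count (mset hs)) L" "codim hs \<le> dimension * length L"
      using exists_long_staircase codim_def by metis
    have "L = []"
    proof (rule ccontr)
      assume "L \<noteq> []"
      then obtain p where p: "p \<in> set L" by (meson last_in_set)
      have "eval_monomial (snd p) m = 0" if "m \<in> Poly_Mapping.keys (fst p)" for m
      proof -
        have "fst p \<in> multilinear_space (count (mset hs))" using L p by (auto simp: staircase_def)
        then have "size (var_mset m) = card (SIGMA g:supp. {1..count (mset hs) g})"
          using that by (auto simp: multilinear_space_def multilinear_polys_def)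
        also have "\<dots> = (\<Sum>g\<in>supp. count (mset hs) g)" using finite_supp by (simp add: card_SigmaI)
        also have "\<dots> = (\<Sum>g\<in>set hs. count (mset hs) g)"
          using hs finite_supp by (intro sum.mono_neutral_right) (auto simp: count_mset_0_iff degree_lists_def)
        also have "\<dots> = n" using size_multiset_overloaded_eq[of "mset hs"] hs by (simp add: degree_lists_def)
        finally show ?thesis using n zero by (cases m) auto
      qed
      then have "diag p = 0" by (simp add: eval_poly_def)
      then show False using staircase_diag(1)[OF L(1) p] by simp
    qed
    then show ?thesis using L by simp
  qed
  then show ?thesis by (simp add: graded_codim_eq)
qed

theorem convergent_root_graded_codim:
  assumes simple: graded_simple
  shows "convergent (\<lambda>n. root n (real (graded_codim n)))"
proof (cases "\<forall>x y. x \<bullet> y = 0")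
  case True
  have "\<forall>\<^sub>F n in sequentially. 0 = root n (real (graded_codim n))"
    using eventually_ge_at_top[of 2] by eventually_elim (use graded_codim_eq_0 True in simp)
  then have "(\<lambda>n. root n (real (graded_codim n))) \<longlonglongrightarrow> 0"
    by (rule Lim_transform_eventually[OF tendsto_const])
  then show ?thesis by (rule convergentI)
next
  case False
  then obtain x0 y0 where nz: "x0 \<bullet> y0 \<noteq> 0" by blast
  obtain K where K: "\<And>m n. graded_codim m * graded_codim n \<le> K * graded_codim (m + n + dimension)"
    using graded_codim_supermultiplicative[OF simple nz] by blast
  show ?thesis
  proof (rule convergent_root_if_almost_supermultiplicative)
    show "real (graded_codim n) > 0" if "n > 0" for n
      using graded_codim_pos[OF simple nz that] by simp
    show "real (graded_codim m) * real (graded_codim n) \<le> real (Suc K) * real (graded_codim (m + n + dimension))" for m n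
    proof -
      have "graded_codim m * graded_codim n \<le> Suc K * graded_codim (m + n + dimension)"
        using K[of m n] by simp
      then show ?thesis by (metis of_nat_le_iff of_nat_mult)
    qed
    show "real (graded_codim n) \<le> real (Suc dimension) * real (Suc (card supp * dimension)) ^ n" for n
    proof -
      have "graded_codim n \<le> dimension * (card supp * dimension) ^ n" by (rule graded_codim_le)
      also have "\<dots> \<le> Suc dimension * Suc (card supp * dimension) ^ n"
        by (intro mult_mono power_mono) auto
      finally show ?thesis by (metis of_nat_le_iff of_nat_mult of_nat_power)
    qed
  qed auto
qed

end

theorem theorem2:
  fixes scale :: "'f::field_char_0 \<Rightarrow> 'a::ab_group_add \<Rightarrow> 'a"
    and mult :: "'a \<Rightarrow> 'a \<Rightarrow> 'a"
    and A :: "'g::ab_semigroup_mult \<Rightarrow> 'a set"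
  assumes "graded_algebra scale mult A"
    and "\<exists>Basis. finite_dimensional_vector_space scale Basis"
    and "graded_algebra.graded_simple scale mult A"
  shows "convergent (\<lambda>n. root n (real (graded_algebra.graded_codim scale mult A n)))"
proof -
  obtain Basis where "finite_dimensional_vector_space scale Basis" using assms(2) by blast
  then interpret finite_dim_graded_algebra scale mult A Basis
    using assms(1) by (intro finite_dim_graded_algebra.intro)
  show ?thesis using assms(3) by (rule convergent_root_graded_codim)
qed

end
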